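(* Fix $\alpha\in(0,\infty)$. Suppose the model $\mathcal P=(P_\theta)_{\theta\in\Theta}$ is DQM at $\theta\in\Theta\subseteq\mathbb R^p$, with score function $s_\theta$, and $Q\in\mathcal Q_\alpha(\mathcal X\to\mathcal Z)$ is a privacy mechanism. Then the model $Q\mathcal P=(QP_\theta)_{\theta\in\Theta}$ is also DQM at $\theta$ with score function $$t_\theta(z):=\mathbb E[s_\theta(X)|Z=z],$$ that is, a regular conditional expectation of $s_\theta(X)$ given $Z=z$, where the joint distribution of $X$ and $Z$ is determined by $X\sim P_\theta$ and $(Z|X=x)\sim Q(dz|x)$. Furthermore, a version of the score can be chosen such that $\sup_{z\in\mathcal Z}\|t_\theta(z)\|\le e^{2\alpha}\sqrt{\operatorname{tr}I_\theta(\mathcal P)}$, and the Fisher information matrix $I_\theta(Q\mathcal P)$ in the model $Q\mathcal P$ satisfies $$I_\theta(Q\mathcal P)=\operatorname{Var}\left[\mathbb E[s_\theta(X)|Z]\right]=I_\theta(\mathcal P)-\mathbb E\left[(s_\theta(X)-t_\theta(Z))(s_\theta(X)-t_\theta(Z))^T\right].$$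
   Context: A model $\mathcal P=(P_\theta)_{\theta\in\Theta}$, $\Theta\subseteq\mathbb R^p$, on a measurable space $(\mathcal X,\mathcal F)$ with $\sigma$-finite dominating measure $\mu$ and densities $p_\theta=dP_\theta/d\mu$ is DQM (differentiable in quadratic mean) at $\theta$ if $\theta$ is an interior point of $\Theta$ and there is a measurable $s_\theta:\mathcal X\to\mathbb R^p$ (the score at $\theta$) with $\int(\sqrt{p_{\theta+h}}-\sqrt{p_\theta}-\frac12h^Ts_\theta\sqrt{p_\theta})^2d\mu=o(\|h\|^2)$ as $h\to0$. This does not depend on the choice of $\mu$. Then $\mathbb E_\theta[s_\theta]=0$ and $I_\theta(\mathcal P):=\mathbb E_\theta[s_\theta s_\theta^T]$ is finite. $\mathcal Q_\alpha(\mathcal X\to\mathcal Z)$ is the set of Markov kernels $Q$ from $(\mathcal X,\mathcal F)$ to a measurable space $(\mathcal Z,\mathcal G)$ with $Q(A|x)\le e^\alpha Q(A|x')$ for all $A\in\mathcal G$, $x,x'\in\mathcal X$. $[QP](A)=\int_{\mathcal X}Q(A|x)P(dx)$. $\operatorname{Var}$ of a random vector denotes its covariance matrix; $\|\cdot\|$ is the Euclidean norm. *)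

theory Defs
  imports "HOL-Probability.Probability"
begin

definition dominating_measure ::
  "'x measure \<Rightarrow> 't set \<Rightarrow> ('t \<Rightarrow> 'x measure) \<Rightarrow> 'x measure \<Rightarrow> bool" where
  "dominating_measure X \<Theta> P \<mu> \<longleftrightarrow>
     sets \<mu> = sets X \<and> sigma_finite_measure \<mu> \<and> (\<forall>\<tau>\<in>\<Theta>. absolutely_continuous \<mu> (P \<tau>))"

definition root_density :: "'x measure \<Rightarrow> ('t \<Rightarrow> 'x measure) \<Rightarrow> 't \<Rightarrow> 'x \<Rightarrow> real" where
  "root_density \<mu> P \<tau> x = sqrt (enn2real (RN_deriv \<mu> (P \<tau>) x))"

text \<open>Differentiability in quadratic mean at \<open>\<theta>\<close> with score \<open>s\<close>, relative to a dominating
  measure \<open>\<mu>\<close>. The integral is taken in the extended nonnegative reals, so that the limit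
  also says that it is finite for all small \<open>h\<close>. Points with \<open>\<theta> + h \<notin> \<Theta>\<close> do not matter since
  \<open>\<theta>\<close> is interior.\<close>

definition dqm_with_score ::
  "'x measure \<Rightarrow> (real^'p) set \<Rightarrow> (real^'p \<Rightarrow> 'x measure) \<Rightarrow> real^'p \<Rightarrow> ('x \<Rightarrow> real^'p) \<Rightarrow> bool" where
  "dqm_with_score \<mu> \<Theta> P \<theta> s \<longleftrightarrow>
     \<theta> \<in> interior \<Theta> \<and> s \<in> borel_measurable \<mu> \<and>
     ((\<lambda>h. (\<integral>\<^sup>+x. ennreal ((root_density \<mu> P (\<theta> + h) x - root_density \<mu> P \<theta> x
                - 1/2 * (h \<bullet> s x) * root_density \<mu> P \<theta> x)\<^sup>2) \<partial>\<mu>)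
          / ennreal ((norm h)\<^sup>2)) \<longlongrightarrow> 0) (at 0)"

definition outer_square :: "real^'p \<Rightarrow> real^'p^'p" where
  "outer_square v = (\<chi> i j. v $ i * v $ j)"

definition fisher_information :: "'x measure \<Rightarrow> ('x \<Rightarrow> real^'p) \<Rightarrow> real^'p^'p" where
  "fisher_information M s = (\<integral>x. outer_square (s x) \<partial>M)"

definition covariance_matrix :: "'a measure \<Rightarrow> ('a \<Rightarrow> real^'p) \<Rightarrow> real^'p^'p" where
  "covariance_matrix M Y = (\<integral>\<omega>. outer_square (Y \<omega> - (\<integral>\<omega>'. Y \<omega>' \<partial>M)) \<partial>M)"

definition private_kernels :: "real \<Rightarrow> 'x measure \<Rightarrow> 'z measure \<Rightarrow> ('x \<Rightarrow> 'z measure) set" where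
  "private_kernels \<alpha> X Z =
     {Q \<in> X \<rightarrow>\<^sub>M prob_algebra Z.
        \<forall>A\<in>sets Z. \<forall>x\<in>space X. \<forall>x'\<in>space X. measure (Q x) A \<le> exp \<alpha> * measure (Q x') A}"

definition private_model :: "('x \<Rightarrow> 'z measure) \<Rightarrow> ('t \<Rightarrow> 'x measure) \<Rightarrow> 't \<Rightarrow> 'z measure" where
  "private_model Q P \<tau> = P \<tau> \<bind> Q"

text \<open>The law of \<open>(X, Z)\<close> when \<open>X\<close> has law \<open>M\<close> and \<open>Z\<close> given \<open>X = x\<close> has law \<open>Q x\<close>.\<close>

definition joint_law ::
  "'x measure \<Rightarrow> 'z measure \<Rightarrow> 'x measure \<Rightarrow> ('x \<Rightarrow> 'z measure) \<Rightarrow> ('x \<times> 'z) measure" where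
  "joint_law X Z M Q = M \<bind> (\<lambda>x. Q x \<bind> (\<lambda>z. return (X \<Otimes>\<^sub>M Z) (x, z)))"

text \<open>\<open>\<bbbE>[f(X) | Z]\<close> as a random vector on the product space: the componentwise conditional
  expectation given the sigma-algebra generated by the second coordinate.\<close>

definition cond_exp_given_snd ::
  "('x \<times> 'z) measure \<Rightarrow> 'z measure \<Rightarrow> ('x \<Rightarrow> real^'p) \<Rightarrow> 'x \<times> 'z \<Rightarrow> real^'p" where
  "cond_exp_given_snd J Z f \<omega> =
     (\<chi> i. real_cond_exp J (vimage_algebra (space J) snd Z) (\<lambda>\<omega>'. f (fst \<omega>') $ i) \<omega>)"

text \<open>\<open>t\<close> is a version of \<open>z \<mapsto> \<bbbE>[f(X) | Z = z]\<close>.\<close>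

definition cond_exp_version ::
  "('x \<times> 'z) measure \<Rightarrow> 'z measure \<Rightarrow> ('x \<Rightarrow> real^'p) \<Rightarrow> ('z \<Rightarrow> real^'p) \<Rightarrow> bool" where
  "cond_exp_version J Z f t \<longleftrightarrow>
     t \<in> borel_measurable Z \<and> (AE \<omega> in J. t (snd \<omega>) = cond_exp_given_snd J Z f \<omega>)"

end

theory Submission
  imports Defs
begin

text \<open>
  The idea is that privacy turns \<open>L\<^sup>1\<close> information about the model into uniform information about
  the privatised model. Write \<open>M\<close> for the law of \<open>Z\<close> at \<open>\<theta>\<close>. As \<open>Q x\<close> is at most \<open>e\<^sup>\<alpha>\<close> times every
  \<open>Q x'\<close>, it is at most \<open>e\<^sup>\<alpha>\<close> times the average \<open>M\<close> of these kernels. Hence a signed measure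
  \<open>A \<mapsto> \<integral> Q x A f(x) \<mu>(dx)\<close> is bounded in absolute value by \<open>e\<^sup>\<alpha> \<parallel>f\<parallel>\<^sub>1 M(A)\<close>, and its density
  with respect to \<open>M\<close> is bounded almost everywhere by \<open>e\<^sup>\<alpha> \<parallel>f\<parallel>\<^sub>1\<close>
  (\<open>abs_integral_Q_measure_le\<close> with \<open>AE_abs_le_if_abs_set_integral_le\<close>). The estimate is used twice.

  \<^item> For \<open>f = s p\<^sub>\<theta>\<close>, componentwise, the density is a version \<open>t\<close> of \<open>\<bbbE>[s(X) | Z]\<close>. Its components
    are bounded by \<open>e\<^sup>\<alpha> \<bbbE>|s\<^sub>i|\<close>, so that \<open>t\<close> has norm at most \<open>e\<^sup>\<alpha>\<close> times the root of the trace of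
    the Fisher information.

  \<^item> For \<open>f = p\<^bsub>\<theta>+h\<^esub> - p\<^sub>\<theta> - (h \<bullet> s) p\<^sub>\<theta>\<close> the \<open>L\<^sup>1\<close> norm is \<open>o(\<parallel>h\<parallel>)\<close> by differentiability in
    quadratic mean (\<open>L1_linearisation\<close>). The density of the law of \<open>Z\<close> at \<open>\<theta> + h\<close> relative to \<open>M\<close>
    is therefore \<open>1 + h \<bullet> t + o(\<parallel>h\<parallel>)\<close>, uniformly in \<open>z\<close>. Since \<open>t\<close> is bounded, the
    square root can be expanded pointwise (\<open>root_remainder_le\<close>), which gives
    \<open>1 + h \<bullet> t / 2 + o(\<parallel>h\<parallel>)\<close> uniformly, and in particular in quadratic mean (\<open>QP_dqm\<close>).

  The argument never disintegrates \<open>Q\<close> by a jointly measurable density, so \<open>Z\<close> may be an arbitrary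
  measurable space. The information identities are the Pythagorean theorem for the conditional
  expectation: \<open>\<bbbE>[s\<^sub>i(X) t\<^sub>j(Z)] = \<bbbE>[t\<^sub>i(Z) t\<^sub>j(Z)]\<close>. The centring term in the covariance is zero
  because the score has mean zero, by the \<open>L\<^sup>1\<close> linearisation integrated over the whole space.
\<close>

section \<open>Two pointwise estimates\<close>

text \<open>The set where \<open>f\<close> exceeds \<open>g\<close> is itself one of the test sets \<open>A\<close>, and there \<open>f - g\<close> is positive
  with integral at most zero, so the set is null. The same applies to \<open>-f\<close>.\<close>

lemma AE_abs_le_if_abs_set_integral_le:
  fixes f g :: "'a \<Rightarrow> real"
  assumes f [measurable]: "integrable M f" and g [measurable]: "integrable M g"
    and le: "\<And>A. A \<in> sets M \<Longrightarrow> \<bar>\<integral>x. indicator A x * f x \<partial>M\<bar> \<le> (\<integral>x. indicator A x * g x \<partial>M)"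
  shows "AE x in M. \<bar>f x\<bar> \<le> g x"
proof -
  have one_sided: "AE x in M. u x \<le> g x"
    if u [measurable]: "integrable M u"
      and u_le: "\<And>A. A \<in> sets M \<Longrightarrow> (\<integral>x. indicator A x * u x \<partial>M) \<le> (\<integral>x. indicator A x * g x \<partial>M)"
    for u :: "'a \<Rightarrow> real"
  proof -
    define A where "A = {x \<in> space M. g x < u x}"
    have A [measurable]: "A \<in> sets M" unfolding A_def by measurable
    have int: "integrable M (\<lambda>x. indicator A x * u x)" "integrable M (\<lambda>x. indicator A x * g x)"
      using integrable_real_mult_indicator[OF A u] integrable_real_mult_indicator[OF A g]
      by (simp_all add: mult.commute)
    have nonneg: "AE x in M. 0 \<le> indicator A x * u x - indicator A x * g x"
      by (auto simp: A_def indicator_def)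
    have "(\<integral>x. indicator A x * u x - indicator A x * g x \<partial>M) \<le> 0"
      using u_le[OF A] int by simp
    moreover have "0 \<le> (\<integral>x. indicator A x * u x - indicator A x * g x \<partial>M)"
      by (rule integral_nonneg_AE[OF nonneg])
    ultimately have "AE x in M. indicator A x * u x - indicator A x * g x = 0"
      using integral_nonneg_eq_0_iff_AE[OF Bochner_Integration.integrable_diff[OF int] nonneg] by linarith
    then show ?thesis
      using AE_space
    proof eventually_elim
      case (elim x)
      then show ?case by (auto simp: A_def indicator_def split: if_splits)
    qed
  qed
  have "AE x in M. f x \<le> g x"
    using le by (intro one_sided f) (meson abs_le_D1)
  moreover have "AE x in M. - f x \<le> g x"
  proof (rule one_sided)
    show "(\<integral>x. indicator A x * - f x \<partial>M) \<le> (\<integral>x. indicator A x * g x \<partial>M)" if "A \<in> sets M" for A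
      using le[OF that] by simp
  qed (use f in simp)
  ultimately show ?thesis by eventually_elim linarith
qed

text \<open>Here \<open>a\<^sup>2\<close> and \<open>b\<^sup>2\<close> are densities at \<open>\<theta> + h\<close> and \<open>\<theta>\<close>, and \<open>u = h \<bullet> t\<close>. With
  \<open>r = a - b - u b / 2\<close> one has \<open>a\<^sup>2 - b\<^sup>2 - u b\<^sup>2 = (a - b)\<^sup>2 + 2 b r\<close>, and \<open>c\<close> controls
  \<open>\<bar>a - b\<bar> \<le> \<bar>a\<^sup>2 - b\<^sup>2\<bar> / b \<le> c b\<close>. When \<open>c = O(\<parallel>h\<parallel>)\<close> and \<open>d = o(\<parallel>h\<parallel>)\<close>, the bound on \<open>r\<close>
  is \<open>o(\<parallel>h\<parallel>) b\<close>, so linearising densities uniformly linearises their roots.\<close>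

lemma root_remainder_le:
  fixes a b u c d :: real
  assumes "0 \<le> a" "0 \<le> b" "0 \<le> c" "0 \<le> d"
    and c: "\<bar>a\<^sup>2 - b\<^sup>2\<bar> \<le> c * b\<^sup>2" and d: "\<bar>a\<^sup>2 - b\<^sup>2 - u * b\<^sup>2\<bar> \<le> d * b\<^sup>2"
  shows "(a - b - 1/2 * u * b)\<^sup>2 \<le> (d + c\<^sup>2)\<^sup>2 * b\<^sup>2"
proof (cases "b = 0")
  case True
  then show ?thesis using c by simp
next
  case False
  with assms have b: "0 < b" by simp
  define r where "r = a - b - 1/2 * u * b"
  have "\<bar>a - b\<bar> * b \<le> \<bar>a - b\<bar> * (a + b)"
    using assms by (intro mult_left_mono) auto
  also have "\<dots> = \<bar>a\<^sup>2 - b\<^sup>2\<bar>"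
    using assms by (simp add: abs_mult power2_eq_square square_diff_square_factored mult.commute)
  finally have "\<bar>a - b\<bar> * b \<le> (c * b) * b" using c by (simp add: power2_eq_square)
  then have ab: "\<bar>a - b\<bar> \<le> c * b" using b by simp
  have "2 * b * r = (a\<^sup>2 - b\<^sup>2 - u * b\<^sup>2) - (a - b)\<^sup>2"
    unfolding r_def by (simp add: power2_eq_square algebra_simps)
  moreover have "(a - b)\<^sup>2 \<le> (c * b)\<^sup>2"
    using ab by (metis abs_ge_zero power2_abs power_mono)
  ultimately have "\<bar>2 * b * r\<bar> \<le> d * b\<^sup>2 + (c * b)\<^sup>2"
    using d zero_le_power2[of "a - b"] by linarith
  then have "2 * b * \<bar>r\<bar> \<le> b * ((d + c\<^sup>2) * b)"
    using b by (simp add: abs_mult power2_eq_square algebra_simps)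
  then have "2 * \<bar>r\<bar> \<le> (d + c\<^sup>2) * b"
    using b by simp
  then have "\<bar>r\<bar> \<le> (d + c\<^sup>2) * b" by linarith
  then have "\<bar>r\<bar>\<^sup>2 \<le> ((d + c\<^sup>2) * b)\<^sup>2" by (intro power_mono) auto
  then show ?thesis unfolding r_def power2_abs by (simp add: power_mult_distrib)
qed

section \<open>Vector-valued integrals by components\<close>

lemma borel_measurable_vec_iff:
  fixes f :: "'a \<Rightarrow> real^'n"
  shows "f \<in> borel_measurable M \<longleftrightarrow> (\<forall>i. (\<lambda>x. f x $ i) \<in> borel_measurable M)"
  by (subst borel_measurable_euclidean_space) (auto simp: Basis_vec_def inner_axis)

lemma borel_measurable_vec_nth [measurable (raw)]:
  fixes f :: "'a \<Rightarrow> real^'n"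
  shows "f \<in> borel_measurable M \<Longrightarrow> (\<lambda>x. f x $ i) \<in> borel_measurable M"
  by (simp add: borel_measurable_vec_iff)

lemma outer_square_nth [simp]: "outer_square v $ i $ j = v $ i * v $ j"
  by (simp add: outer_square_def)

lemma integrable_vec_iff:
  fixes f :: "'a \<Rightarrow> ('b::euclidean_space)^'n"
  shows "integrable M f \<longleftrightarrow> (\<forall>i. integrable M (\<lambda>x. f x $ i))"
proof
  assume "integrable M f"
  then show "\<forall>i. integrable M (\<lambda>x. f x $ i)"
    by (blast intro: integrable_bounded_linear[OF bounded_linear_vec_nth])
next
  assume *: "\<forall>i. integrable M (\<lambda>x. f x $ i)"
  have "integrable M (\<lambda>x. \<Sum>i\<in>UNIV. axis i (f x $ i))"
  proof (intro Bochner_Integration.integrable_sum)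
    fix i
    have "bounded_linear (axis i :: 'b \<Rightarrow> 'b^'n)"
    proof (intro linear_conv_bounded_linear[THEN iffD1] linearI)
      show "axis i (x + y) = axis i x + (axis i y :: 'b^'n)" for x y
        by (simp add: vec_eq_iff axis_def)
      show "axis i (c *\<^sub>R x) = c *\<^sub>R (axis i x :: 'b^'n)" for c x
        by (simp add: vec_eq_iff axis_def)
    qed
    then show "integrable M (\<lambda>x. axis i (f x $ i))"
      by (rule integrable_bounded_linear) (use * in simp)
  qed
  also have "(\<lambda>x. \<Sum>i\<in>UNIV. axis i (f x $ i)) = f"
    by (rule ext) (simp add: vec_eq_iff sum_component axis_def)
  finally show "integrable M f" .
qed

lemma integral_vec_nth:
  fixes f :: "'a \<Rightarrow> ('b::euclidean_space)^'n"
  assumes "integrable M f"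
  shows "(\<integral>x. f x \<partial>M) $ i = (\<integral>x. f x $ i \<partial>M)"
  using integral_bounded_linear[OF bounded_linear_vec_nth assms] by simp

lemma integrable_outer_square_iff:
  "integrable M (\<lambda>x. outer_square (f x)) \<longleftrightarrow> (\<forall>i j. integrable M (\<lambda>x. f x $ i * f x $ j))"
  by (simp add: integrable_vec_iff)

lemma integral_outer_square_nth:
  assumes "integrable M (\<lambda>x. outer_square (f x))"
  shows "(\<integral>x. outer_square (f x) \<partial>M) $ i $ j = (\<integral>x. f x $ i * f x $ j \<partial>M)"
  using assms by (simp add: integrable_vec_iff integral_vec_nth)

section \<open>Root densities of dominated models\<close>

locale dominated_model =
  fixes X :: "'x measure" and \<Theta> :: "(real^'p) set" and P :: "real^'p \<Rightarrow> 'x measure"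
    and \<mu> :: "'x measure"
  assumes laws: "\<forall>\<tau>\<in>\<Theta>. P \<tau> \<in> space (prob_algebra X)"
    and dominated: "dominating_measure X \<Theta> P \<mu>"
begin

abbreviation rt where "rt \<equiv> root_density \<mu> P"

lemma sets_\<mu>: "sets \<mu> = sets X"
  using dominated by (simp add: dominating_measure_def)

lemma sets_law: "\<tau> \<in> \<Theta> \<Longrightarrow> sets (P \<tau>) = sets X"
  using laws by (auto simp: space_prob_algebra)

lemma prob_space_law: "\<tau> \<in> \<Theta> \<Longrightarrow> prob_space (P \<tau>)"
  using laws by (auto simp: space_prob_algebra)

lemma borel_measurable_root_density [measurable]: "rt \<tau> \<in> borel_measurable \<mu>"
  unfolding root_density_def[abs_def] by measurable

lemma root_density_nonneg: "0 \<le> rt \<tau> x"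
  by (simp add: root_density_def)

text \<open>The root density is defined through \<^const>\<open>enn2real\<close>, which sends an infinite density to zero.
  The law is finite, so its density is finite almost everywhere and nothing is lost.\<close>

lemma law_eq_density:
  assumes "\<tau> \<in> \<Theta>"
  shows "P \<tau> = density \<mu> (\<lambda>x. ennreal ((rt \<tau> x)\<^sup>2))"
proof -
  interpret sigma_finite_measure \<mu> using dominated by (simp add: dominating_measure_def)
  interpret P: prob_space "P \<tau>" using prob_space_law[OF assms] .
  have ac: "absolutely_continuous \<mu> (P \<tau>)"
    using dominated assms by (simp add: dominating_measure_def)
  have eq: "sets (P \<tau>) = sets \<mu>" by (simp add: sets_law[OF assms] sets_\<mu>)
  have "AE x in \<mu>. RN_deriv \<mu> (P \<tau>) x \<noteq> \<infinity>"
    by (rule RN_deriv_finite[OF _ ac eq]) unfold_locales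
  then have "AE x in \<mu>. RN_deriv \<mu> (P \<tau>) x = ennreal ((rt \<tau> x)\<^sup>2)"
    by eventually_elim (simp add: root_density_def less_top)
  then have "density \<mu> (RN_deriv \<mu> (P \<tau>)) = density \<mu> (\<lambda>x. ennreal ((rt \<tau> x)\<^sup>2))"
    by (intro density_cong) auto
  then show ?thesis using density_RN_deriv[OF ac eq] by simp
qed

lemma integrable_law_iff:
  fixes f :: "'x \<Rightarrow> real"
  assumes "\<tau> \<in> \<Theta>" "f \<in> borel_measurable X"
  shows "integrable (P \<tau>) f \<longleftrightarrow> integrable \<mu> (\<lambda>x. f x * (rt \<tau> x)\<^sup>2)"
proof -
  have [measurable]: "f \<in> borel_measurable \<mu>" using assms sets_\<mu> by (simp cong: measurable_cong_sets)
  show ?thesis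
    by (subst law_eq_density[OF assms(1)], subst integrable_density) (auto simp: mult.commute)
qed

lemma integral_law:
  fixes f :: "'x \<Rightarrow> real"
  assumes "\<tau> \<in> \<Theta>" "f \<in> borel_measurable X"
  shows "(\<integral>x. f x \<partial>P \<tau>) = (\<integral>x. f x * (rt \<tau> x)\<^sup>2 \<partial>\<mu>)"
proof -
  have [measurable]: "f \<in> borel_measurable \<mu>" using assms sets_\<mu> by (simp cong: measurable_cong_sets)
  show ?thesis
    by (subst law_eq_density[OF assms(1)], subst integral_density) (auto simp: mult.commute)
qed

lemma integrable_root_density_square:
  assumes "\<tau> \<in> \<Theta>"
  shows "integrable \<mu> (\<lambda>x. (rt \<tau> x)\<^sup>2)"
proof -
  interpret prob_space "P \<tau>" by (rule prob_space_law[OF assms])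
  show ?thesis using integrable_law_iff[OF assms, of "\<lambda>_. 1"] by simp
qed

lemma integral_root_density_square:
  assumes "\<tau> \<in> \<Theta>"
  shows "(\<integral>x. (rt \<tau> x)\<^sup>2 \<partial>\<mu>) = 1"
proof -
  interpret prob_space "P \<tau>" by (rule prob_space_law[OF assms])
  show ?thesis using integral_law[OF assms, of "\<lambda>_. 1"] by (simp add: prob_space)
qed

definition remainder where
  "remainder \<theta> s h x = rt (\<theta> + h) x - rt \<theta> x - 1/2 * (h \<bullet> s x) * rt \<theta> x"

lemma borel_measurable_remainder [measurable]:
  assumes [measurable]: "s \<in> borel_measurable \<mu>"
  shows "remainder \<theta> s h \<in> borel_measurable \<mu>"
  unfolding remainder_def[abs_def] by measurable

text \<open>The limit in the definition lives in the extended nonnegative reals. This form, with Bochner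
  integrals and an explicit \<open>e\<close>, is the one that can be combined with other estimates.\<close>

lemma dqm_remainder_le:
  assumes dqm: "dqm_with_score \<mu> \<Theta> P \<theta> s" and "0 < e"
  shows "\<forall>\<^sub>F h in at 0. integrable \<mu> (\<lambda>x. (remainder \<theta> s h x)\<^sup>2) \<and>
           (\<integral>x. (remainder \<theta> s h x)\<^sup>2 \<partial>\<mu>) \<le> e * (norm h)\<^sup>2"
proof -
  have [measurable]: "s \<in> borel_measurable \<mu>" using dqm by (simp add: dqm_with_score_def)
  have "((\<lambda>h. (\<integral>\<^sup>+x. ennreal ((remainder \<theta> s h x)\<^sup>2) \<partial>\<mu>) / ennreal ((norm h)\<^sup>2)) \<longlongrightarrow> 0) (at 0)"
    using dqm by (simp add: dqm_with_score_def remainder_def)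
  then have "\<forall>\<^sub>F h in at 0. (\<integral>\<^sup>+x. ennreal ((remainder \<theta> s h x)\<^sup>2) \<partial>\<mu>) / ennreal ((norm h)\<^sup>2) < ennreal e"
    using \<open>0 < e\<close> by (intro order_tendstoD(2)) auto
  moreover have "\<forall>\<^sub>F h in at (0 :: real^'p). h \<noteq> 0" by (rule eventually_neq_at_within)
  ultimately show ?thesis
  proof eventually_elim
    case (elim h)
    let ?I = "\<integral>\<^sup>+x. ennreal ((remainder \<theta> s h x)\<^sup>2) \<partial>\<mu>"
    have pos: "0 < (norm h)\<^sup>2" using elim by simp
    have "?I = ?I / ennreal ((norm h)\<^sup>2) * ennreal ((norm h)\<^sup>2)"
      using pos by (simp add: ennreal_divide_times divide_eq_1_ennreal)
    also have "\<dots> \<le> ennreal e * ennreal ((norm h)\<^sup>2)"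
      using elim(1) by (intro mult_right_mono) auto
    finally have I: "?I \<le> ennreal (e * (norm h)\<^sup>2)"
      using \<open>0 < e\<close> by (simp add: ennreal_mult)
    have int: "integrable \<mu> (\<lambda>x. (remainder \<theta> s h x)\<^sup>2)"
      using I by (intro integrableI_nonneg) (auto intro: le_less_trans)
    have "ennreal (\<integral>x. (remainder \<theta> s h x)\<^sup>2 \<partial>\<mu>) \<le> ennreal (e * (norm h)\<^sup>2)"
      using I nn_integral_eq_integral[OF int] by simp
    then show ?case using int \<open>0 < e\<close> by (subst (asm) ennreal_le_iff) auto
  qed
qed

lemma dqm_with_scoreI:
  assumes int: "\<theta> \<in> interior \<Theta>" and [measurable]: "s \<in> borel_measurable \<mu>"
    and le: "\<And>e. 0 < e \<Longrightarrow> \<forall>\<^sub>F h in at 0.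
      (\<integral>\<^sup>+x. ennreal ((remainder \<theta> s h x)\<^sup>2) \<partial>\<mu>) \<le> ennreal (e * (norm h)\<^sup>2)"
  shows "dqm_with_score \<mu> \<Theta> P \<theta> s"
proof -
  have "((\<lambda>h. (\<integral>\<^sup>+x. ennreal ((remainder \<theta> s h x)\<^sup>2) \<partial>\<mu>) / ennreal ((norm h)\<^sup>2)) \<longlongrightarrow> 0) (at 0)"
  proof (rule order_tendstoI)
    fix a :: ennreal assume "0 < a"
    then obtain e' where e': "0 < e'" "e' < a" using dense by blast
    then have "e' < \<top>" by (meson less_le_trans top_greatest)
    with e' obtain e where e: "e' = ennreal e" "0 < e"
      by (metis enn2real_positive_iff ennreal_enn2real)
    have "\<forall>\<^sub>F h in at (0 :: real^'p). h \<noteq> 0" by (rule eventually_neq_at_within)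
    with le[OF e(2)] show "\<forall>\<^sub>F h in at 0.
        (\<integral>\<^sup>+x. ennreal ((remainder \<theta> s h x)\<^sup>2) \<partial>\<mu>) / ennreal ((norm h)\<^sup>2) < a"
    proof eventually_elim
      case (elim h)
      then have "(\<integral>\<^sup>+x. ennreal ((remainder \<theta> s h x)\<^sup>2) \<partial>\<mu>) / ennreal ((norm h)\<^sup>2)
          \<le> ennreal (e * (norm h)\<^sup>2) / ennreal ((norm h)\<^sup>2)"
        by (intro divide_right_mono_ennreal)
      also have "\<dots> = e'" using elim e by (simp add: divide_ennreal)
      finally show ?case using e'(2) by simp
    qed
  qed auto
  then show ?thesis using assms by (simp add: dqm_with_score_def remainder_def)
qed

lemma eventually_in_parameter_set:
  assumes "\<theta> \<in> interior \<Theta>"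
  shows "\<forall>\<^sub>F h in at 0. \<theta> + h \<in> \<Theta>"
proof -
  have "((\<lambda>h. \<theta> + h) \<longlongrightarrow> \<theta> + 0) (at 0)" by (intro tendsto_intros)
  then have "\<forall>\<^sub>F h in at 0. \<theta> + h \<in> interior \<Theta>"
    using assms by (intro topological_tendstoD) auto
  then show ?thesis by eventually_elim (use interior_subset in blast)
qed

end

section \<open>Consequences of differentiability in quadratic mean\<close>

text \<open>Extracting componentwise facts about the score from a limit as \<open>h \<rightarrow> 0\<close> needs only a
  single small increment along each coordinate axis.\<close>

lemma eventually_at_0_axis:
  fixes R :: "real^'n \<Rightarrow> bool"
  assumes "\<forall>\<^sub>F h in at 0. R h"
  obtains c where "0 < c" "R (c *\<^sub>R axis i 1)"
proof -
  from assms obtain d where d: "0 < d" "\<And>h. h \<noteq> 0 \<Longrightarrow> dist h 0 < d \<Longrightarrow> R h"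
    by (auto simp: eventually_at)
  have "R ((d/2) *\<^sub>R axis i 1)"
    using d(1) by (intro d(2)) (auto simp: axis_eq_0_iff)
  with d(1) show thesis by (intro that[of "d/2"]) auto
qed

locale dqm_model = dominated_model X \<Theta> P \<mu>
  for X :: "'x measure" and \<Theta> :: "(real^'p) set" and P :: "real^'p \<Rightarrow> 'x measure"
    and \<mu> :: "'x measure" +
  fixes \<theta> :: "real^'p" and s :: "'x \<Rightarrow> real^'p"
  assumes dqm: "dqm_with_score \<mu> \<Theta> P \<theta> s"
begin

lemma \<theta>_interior: "\<theta> \<in> interior \<Theta>"
  using dqm by (simp add: dqm_with_score_def)

lemma \<theta>_in [simp]: "\<theta> \<in> \<Theta>"
  using \<theta>_interior interior_subset by blast

sublocale law: prob_space "P \<theta>"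
  by (rule prob_space_law) simp

lemma sets_law_\<theta> [measurable_cong]: "sets (P \<theta>) = sets X"
  by (rule sets_law) simp

lemma score_measurable_dom [measurable]: "s \<in> borel_measurable \<mu>"
  using dqm by (simp add: dqm_with_score_def)

lemma score_measurable [measurable]: "s \<in> borel_measurable X"
  using score_measurable_dom sets_\<mu> by (simp cong: measurable_cong_sets)

text \<open>For one small \<open>c\<close>, with \<open>h\<close> equal to \<open>c\<close> times the \<open>i\<close>-th unit vector, the remainder is square
  integrable. So are both root densities, hence so is the linear term \<open>c s\<^sub>i b / 2\<close> that the
  remainder compares them with.\<close>

lemma integrable_score_component_square: "integrable (P \<theta>) (\<lambda>x. (s x $ i)\<^sup>2)"
proof -
  have "\<forall>\<^sub>F h in at 0. integrable \<mu> (\<lambda>x. (remainder \<theta> s h x)\<^sup>2) \<and> \<theta> + h \<in> \<Theta>"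
    using dqm_remainder_le[OF dqm zero_less_one] eventually_in_parameter_set[OF \<theta>_interior]
    by eventually_elim simp
  then obtain c where c: "0 < c" and r: "integrable \<mu> (\<lambda>x. (remainder \<theta> s (c *\<^sub>R axis i 1) x)\<^sup>2)"
    and \<tau>: "\<theta> + c *\<^sub>R axis i 1 \<in> \<Theta>"
    by (rule eventually_at_0_axis[of _ i]) auto
  let ?a = "rt (\<theta> + c *\<^sub>R axis i 1)" and ?b = "rt \<theta>" and ?r = "remainder \<theta> s (c *\<^sub>R axis i 1)"
  have int: "integrable \<mu> (\<lambda>x. 12 / c\<^sup>2 * ((?a x)\<^sup>2 + (?b x)\<^sup>2 + (?r x)\<^sup>2))"
    using r integrable_root_density_square[OF \<tau>] integrable_root_density_square[OF \<theta>_in] by simp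
  have "integrable \<mu> (\<lambda>x. (s x $ i)\<^sup>2 * (?b x)\<^sup>2)"
  proof (rule Bochner_Integration.integrable_bound[OF int])
    show "AE x in \<mu>. norm ((s x $ i)\<^sup>2 * (?b x)\<^sup>2) \<le> norm (12 / c\<^sup>2 * ((?a x)\<^sup>2 + (?b x)\<^sup>2 + (?r x)\<^sup>2))"
    proof (rule AE_I2)
      fix x
      define u v w where "u = ?a x" and "v = ?b x" and "w = ?r x"
      have "c * (s x $ i * v) = 2 * (u - v - w)"
        unfolding u_def v_def w_def by (simp add: remainder_def inner_axis')
      then have "c\<^sup>2 * ((s x $ i)\<^sup>2 * v\<^sup>2) = 4 * (u - v - w)\<^sup>2"
        by (metis (no_types) power_mult_distrib four_x_squared)
      also have "(u - v - w)\<^sup>2 \<le> 3 * (u\<^sup>2 + v\<^sup>2 + w\<^sup>2)"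
      proof -
        have "0 \<le> (u + v)\<^sup>2 + (u + w)\<^sup>2 + (v - w)\<^sup>2" by simp
        then show ?thesis by (simp add: power2_eq_square algebra_simps)
      qed
      finally have "c\<^sup>2 * ((s x $ i)\<^sup>2 * v\<^sup>2) \<le> 12 * (u\<^sup>2 + v\<^sup>2 + w\<^sup>2)" by simp
      then show "norm ((s x $ i)\<^sup>2 * (?b x)\<^sup>2) \<le> norm (12 / c\<^sup>2 * ((?a x)\<^sup>2 + (?b x)\<^sup>2 + (?r x)\<^sup>2))"
        using c unfolding u_def v_def w_def by (simp add: pos_le_divide_eq mult.commute)
    qed
  qed measurable
  then show ?thesis by (subst integrable_law_iff) auto
qed

lemma integrable_score_product: "integrable (P \<theta>) (\<lambda>x. s x $ i * s x $ j)"
proof (rule Bochner_Integration.integrable_bound)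
  show "integrable (P \<theta>) (\<lambda>x. (s x $ i)\<^sup>2 + (s x $ j)\<^sup>2)"
    by (intro Bochner_Integration.integrable_add integrable_score_component_square)
  have "\<bar>a * b\<bar> \<le> a\<^sup>2 + b\<^sup>2" for a b :: real
  proof -
    have "0 \<le> (a - b)\<^sup>2" "0 \<le> (a + b)\<^sup>2" "0 \<le> a\<^sup>2 + b\<^sup>2" by simp_all
    then show ?thesis unfolding power2_diff power2_sum abs_le_iff by linarith
  qed
  then show "AE x in P \<theta>. norm (s x $ i * s x $ j) \<le> norm ((s x $ i)\<^sup>2 + (s x $ j)\<^sup>2)"
    by simp
qed measurable

lemma integrable_score_outer_square: "integrable (P \<theta>) (\<lambda>x. outer_square (s x))"
  by (simp add: integrable_outer_square_iff integrable_score_product)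

lemma integrable_score_component: "integrable (P \<theta>) (\<lambda>x. s x $ i)"
  by (rule law.square_integrable_imp_integrable[OF _ integrable_score_component_square]) measurable

lemma integrable_norm_score_square: "integrable (P \<theta>) (\<lambda>x. (norm (s x))\<^sup>2)"
proof -
  have "(\<lambda>x. (norm (s x))\<^sup>2) = (\<lambda>x. \<Sum>i\<in>UNIV. (s x $ i)\<^sup>2)"
    unfolding power2_norm_eq_inner by (simp add: inner_vec_def power2_eq_square)
  then show ?thesis using integrable_score_component_square by simp
qed

lemma integrable_inner_score: "integrable (P \<theta>) (\<lambda>x. h \<bullet> s x)"
  using integrable_score_component by (simp add: inner_vec_def)

text \<open>The first-order expansion of the density itself, in contrast to \<open>remainder\<close>, which expands
  its square root.\<close>

definition linearisation_error where
  "linearisation_error h x = (rt (\<theta> + h) x)\<^sup>2 - (rt \<theta> x)\<^sup>2 - (h \<bullet> s x) * (rt \<theta> x)\<^sup>2"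

lemma linearisation_error_measurable [measurable]: "linearisation_error h \<in> borel_measurable \<mu>"
  unfolding linearisation_error_def[abs_def] by measurable

lemma integrable_linearisation_error:
  assumes "\<theta> + h \<in> \<Theta>"
  shows "integrable \<mu> (linearisation_error h)"
  unfolding linearisation_error_def[abs_def]
  using integrable_root_density_square[OF assms] integrable_root_density_square[OF \<theta>_in]
    integrable_inner_score[of h] by (subst (asm) integrable_law_iff) auto

text \<open>Differentiability in quadratic mean of the root density implies differentiability in \<open>L\<^sup>1\<close> of the
  density. With \<open>a\<close>, \<open>b\<close> the roots, \<open>r\<close> the remainder and \<open>u = h \<bullet> s\<close>, the error is
  \<open>(a - b)\<^sup>2 + 2 b r\<close>. The first term is \<open>(r + u b / 2)\<^sup>2\<close>, with integral \<open>O(\<parallel>h\<parallel>\<^sup>2)\<close>. For the second,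
  the weighted inequality \<open>2 \<bar>b r\<bar> \<le> q b\<^sup>2 + r\<^sup>2 / q\<close> with \<open>q = \<delta> \<parallel>h\<parallel>\<close> replaces the
  Cauchy-Schwarz inequality, and \<open>\<integral> r\<^sup>2 \<le> \<delta>\<^sup>2 \<parallel>h\<parallel>\<^sup>2\<close> makes both of its parts at most \<open>\<delta> \<parallel>h\<parallel>\<close>.\<close>

lemma L1_linearisation:
  assumes e: "0 < e"
  shows "\<forall>\<^sub>F h in at 0. \<theta> + h \<in> \<Theta> \<and> (\<integral>x. \<bar>linearisation_error h x\<bar> \<partial>\<mu>) \<le> e * norm h"
proof -
  define K where "K = (\<integral>x. (norm (s x))\<^sup>2 \<partial>P \<theta>)"
  \<comment> \<open>Three terms of size \<open>\<delta> \<parallel>h\<parallel>\<close> remain: both parts of the weighted inequality, and the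
    quadratic terms, which are collected in \<open>C\<close>.\<close>
  define \<delta> where "\<delta> = e / 3"
  have \<delta>: "0 < \<delta>" using e by (simp add: \<delta>_def)
  define C where "C = 2 * \<delta>\<^sup>2 + K / 2"
  have C: "0 \<le> C" unfolding C_def K_def by (intro add_nonneg_nonneg) auto
  have "((\<lambda>h::real^'p. C * norm h) \<longlongrightarrow> C * norm (0 :: real^'p)) (at 0)"
    by (intro tendsto_intros)
  then have small: "\<forall>\<^sub>F h in at (0 :: real^'p). C * norm h < \<delta>"
    using \<delta> by (intro order_tendstoD(2)) auto
  have "0 < \<delta>\<^sup>2" using \<delta> by simp
  from dqm_remainder_le[OF dqm this] small eventually_in_parameter_set[OF \<theta>_interior]
    eventually_neq_at_within[of 0 "0 :: real^'p" UNIV]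
  show ?thesis
  proof eventually_elim
    case (elim h)
    define n where "n = norm h"
    have n: "0 < n" using elim by (simp add: n_def)
    let ?r = "remainder \<theta> s h"
    have r: "integrable \<mu> (\<lambda>x. (?r x)\<^sup>2)" "(\<integral>x. (?r x)\<^sup>2 \<partial>\<mu>) \<le> \<delta>\<^sup>2 * n\<^sup>2"
      using elim(1) by (auto simp: n_def)
    have b: "integrable \<mu> (\<lambda>x. (rt \<theta> x)\<^sup>2)" "(\<integral>x. (rt \<theta> x)\<^sup>2 \<partial>\<mu>) = 1"
      by (simp_all add: integrable_root_density_square integral_root_density_square)
    have sb: "integrable \<mu> (\<lambda>x. (norm (s x))\<^sup>2 * (rt \<theta> x)\<^sup>2)"
        "(\<integral>x. (norm (s x))\<^sup>2 * (rt \<theta> x)\<^sup>2 \<partial>\<mu>) = K"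
      using integrable_norm_score_square unfolding K_def
      by (subst (asm) integrable_law_iff, simp_all) (subst integral_law, simp_all)
    define B where "B x = (2 + 1 / (\<delta> * n)) * (?r x)\<^sup>2 + n\<^sup>2 / 2 * ((norm (s x))\<^sup>2 * (rt \<theta> x)\<^sup>2)
        + \<delta> * n * (rt \<theta> x)\<^sup>2" for x
    have "\<bar>linearisation_error h x\<bar> \<le> B x" for x
    proof -
      define a b r u where "a = rt (\<theta> + h) x" and "b = rt \<theta> x" and "r = ?r x" and "u = h \<bullet> s x"
      have r: "r = a - b - 1/2 * u * b" by (simp add: a_def b_def r_def u_def remainder_def)
      have "linearisation_error h x = a\<^sup>2 - b\<^sup>2 - u * b\<^sup>2"
        by (simp add: linearisation_error_def a_def b_def u_def)
      also have "\<dots> = (r + 1/2 * u * b)\<^sup>2 + 2 * b * r"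
        unfolding r by (simp add: power2_eq_square algebra_simps)
      finally have "\<bar>linearisation_error h x\<bar> \<le> (r + 1/2 * u * b)\<^sup>2 + \<bar>2 * b * r\<bar>"
        by (smt (verit) zero_le_power2)
      moreover have "(r + 1/2 * u * b)\<^sup>2 \<le> 2 * r\<^sup>2 + u\<^sup>2 * b\<^sup>2 / 2"
      proof -
        have "0 \<le> (r - 1/2 * u * b)\<^sup>2" by simp
        then show ?thesis by (simp add: power2_eq_square algebra_simps)
      qed
      moreover have "u\<^sup>2 * b\<^sup>2 \<le> n\<^sup>2 * ((norm (s x))\<^sup>2 * b\<^sup>2)"
      proof -
        have "u\<^sup>2 \<le> (n * norm (s x))\<^sup>2"
          using Cauchy_Schwarz_ineq2[of h "s x"] by (metis abs_ge_zero n_def power2_abs power_mono u_def)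
        then show ?thesis
          by (metis mult.assoc mult_right_mono power_mult_distrib zero_le_power2)
      qed
      moreover have "\<bar>2 * b * r\<bar> \<le> \<delta> * n * b\<^sup>2 + 1 / (\<delta> * n) * r\<^sup>2"
      proof -
        define q where "q = \<delta> * n"
        have q: "0 < q" using \<delta> n by (simp add: q_def)
        have "0 \<le> (q * \<bar>b\<bar> - \<bar>r\<bar>)\<^sup>2" by simp
        then have "q * \<bar>2 * b * r\<bar> \<le> q\<^sup>2 * b\<^sup>2 + r\<^sup>2"
          by (simp add: power2_diff power_mult_distrib abs_mult mult_ac)
        then have "\<bar>2 * b * r\<bar> \<le> (q\<^sup>2 * b\<^sup>2 + r\<^sup>2) / q"
          using q by (simp add: pos_le_divide_eq mult.commute)
        also have "\<dots> = q * b\<^sup>2 + 1 / q * r\<^sup>2"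
          using q by (simp add: field_simps power2_eq_square)
        finally show ?thesis by (simp add: q_def)
      qed
      ultimately show ?thesis
        unfolding B_def b_def[symmetric] r_def[symmetric] by (simp add: distrib_right)
    qed
    moreover have B: "integrable \<mu> B"
      unfolding B_def[abs_def] using r b sb by simp
    ultimately have "(\<integral>x. \<bar>linearisation_error h x\<bar> \<partial>\<mu>) \<le> (\<integral>x. B x \<partial>\<mu>)"
      using integrable_linearisation_error[of h] elim by (intro integral_mono) auto
    also have "\<dots> = (2 + 1 / (\<delta> * n)) * (\<integral>x. (?r x)\<^sup>2 \<partial>\<mu>) + n\<^sup>2 / 2 * K + \<delta> * n"
      unfolding B_def[abs_def] using r b sb by simp
    also have "\<dots> \<le> (2 + 1 / (\<delta> * n)) * (\<delta>\<^sup>2 * n\<^sup>2) + n\<^sup>2 / 2 * K + \<delta> * n"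
      using r(2) \<delta> n by (intro add_right_mono mult_left_mono) auto
    also have "\<dots> = (C * n) * n + 2 * \<delta> * n"
      using \<delta> n unfolding C_def by (simp add: field_simps power2_eq_square)
    also have "\<dots> \<le> \<delta> * n + 2 * \<delta> * n"
      using elim(2) n by (intro add_right_mono mult_right_mono) (auto simp: n_def)
    also have "\<dots> = e * norm h" by (simp add: \<delta>_def n_def)
    finally show ?case using elim by simp
  qed
qed

text \<open>The total masses at \<open>\<theta> + h\<close> and \<open>\<theta>\<close> cancel in the integrated linearisation error, which leaves
  \<open>\<bar>h \<bullet> \<bbbE>[s]\<bar> = o(\<parallel>h\<parallel>)\<close>.\<close>

lemma score_mean_zero: "(\<integral>x. s x $ i \<partial>P \<theta>) = 0"
proof -
  have "\<bar>\<integral>x. s x $ i \<partial>P \<theta>\<bar> \<le> e" if "0 < e" for e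
  proof -
    from L1_linearisation[OF that] obtain c where c: "0 < c" and \<tau>: "\<theta> + c *\<^sub>R axis i 1 \<in> \<Theta>"
      and le: "(\<integral>x. \<bar>linearisation_error (c *\<^sub>R axis i 1) x\<bar> \<partial>\<mu>) \<le> e * norm (c *\<^sub>R axis i (1::real))"
      by (rule eventually_at_0_axis[of _ i]) auto
    have "integrable \<mu> (\<lambda>x. s x $ i * (rt \<theta> x)\<^sup>2)"
      using integrable_score_component[of i] by (subst (asm) integrable_law_iff) auto
    then have "(\<integral>x. linearisation_error (c *\<^sub>R axis i 1) x \<partial>\<mu>) = - c * (\<integral>x. s x $ i \<partial>P \<theta>)"
      using integrable_root_density_square[OF \<tau>] integrable_root_density_square[OF \<theta>_in]
        integral_root_density_square[OF \<tau>] integral_root_density_square[OF \<theta>_in]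
      by (simp add: linearisation_error_def inner_axis' integral_law mult.assoc)
    then have "c * \<bar>\<integral>x. s x $ i \<partial>P \<theta>\<bar> = \<bar>\<integral>x. linearisation_error (c *\<^sub>R axis i 1) x \<partial>\<mu>\<bar>"
      using c by (simp add: abs_mult)
    also have "\<dots> \<le> e * c"
      using le c by (intro order_trans[OF integral_abs_bound]) simp
    finally show ?thesis using c by (simp add: mult.commute)
  qed
  then have "\<bar>\<integral>x. s x $ i \<partial>P \<theta>\<bar> \<le> 0" by (rule field_le_epsilon[where y = 0, simplified])
  then show ?thesis by simp
qed

end

section \<open>Joint laws and conditional expectations given the output of a channel\<close>

locale channel =
  fixes X :: "'x measure" and Z :: "'z measure" and M :: "'x measure" and Q :: "'x \<Rightarrow> 'z measure"
  assumes M_in: "M \<in> space (prob_algebra X)"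
    and Q_kernel [measurable]: "Q \<in> X \<rightarrow>\<^sub>M prob_algebra Z"
begin

abbreviation "J \<equiv> joint_law X Z M Q"
abbreviation "N \<equiv> M \<bind> Q"
abbreviation "F \<equiv> vimage_algebra (space J) snd Z"

sublocale M: prob_space M
  using M_in by (simp add: space_prob_algebra)

lemma sets_M [measurable_cong]: "sets M = sets X"
  using M_in by (simp add: space_prob_algebra)

lemma space_M: "space M = space X"
  by (rule sets_eq_imp_space_eq[OF sets_M])

lemma Q_kernel_M: "Q \<in> M \<rightarrow>\<^sub>M prob_algebra Z"
  by measurable

lemma Q_subprob: "Q \<in> M \<rightarrow>\<^sub>M subprob_algebra Z"
  by (rule measurable_prob_algebraD[OF Q_kernel_M])

lemma Q_prob_space: "x \<in> space X \<Longrightarrow> prob_space (Q x)"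
  and sets_Q: "x \<in> space X \<Longrightarrow> sets (Q x) = sets Z"
  using measurable_space[OF Q_kernel] by (auto simp: space_prob_algebra)

lemma pair_kernel: "(\<lambda>x. Q x \<bind> (\<lambda>z. return (X \<Otimes>\<^sub>M Z) (x, z))) \<in> M \<rightarrow>\<^sub>M prob_algebra (X \<Otimes>\<^sub>M Z)"
  by measurable

lemma M_in': "M \<in> space (prob_algebra M)"
  by (simp add: space_prob_algebra M.prob_space_axioms)

sublocale N: prob_space N
  by (rule prob_space_bind'[OF M_in' Q_kernel_M])

sublocale J: prob_space J
  unfolding joint_law_def by (rule prob_space_bind'[OF M_in' pair_kernel])

lemma sets_N [measurable_cong]: "sets N = sets Z"
  by (rule sets_bind'[OF M_in' Q_kernel_M])

lemma sets_J [measurable_cong]: "sets J = sets (X \<Otimes>\<^sub>M Z)"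
  unfolding joint_law_def by (rule sets_bind'[OF M_in' pair_kernel])

lemma space_J: "space J = space X \<times> space Z"
  using sets_eq_imp_space_eq[OF sets_J] by (simp add: space_pair_measure)

lemma nn_integral_J:
  assumes [measurable]: "g \<in> borel_measurable (X \<Otimes>\<^sub>M Z)"
  shows "(\<integral>\<^sup>+\<omega>. g \<omega> \<partial>J) = (\<integral>\<^sup>+x. \<integral>\<^sup>+z. g (x, z) \<partial>Q x \<partial>M)"
  unfolding joint_law_def
proof (subst nn_integral_bind[OF assms measurable_prob_algebraD[OF pair_kernel]], rule nn_integral_cong)
  fix x assume "x \<in> space M"
  then have x [measurable]: "x \<in> space X" by (simp add: space_M)
  note sets_Q[OF x, measurable_cong]
  have "(\<lambda>z. return (X \<Otimes>\<^sub>M Z) (x, z)) \<in> Q x \<rightarrow>\<^sub>M prob_algebra (X \<Otimes>\<^sub>M Z)" by measurable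
  then have "(\<integral>\<^sup>+\<omega>. g \<omega> \<partial>(Q x \<bind> (\<lambda>z. return (X \<Otimes>\<^sub>M Z) (x, z)))) =
      (\<integral>\<^sup>+z. \<integral>\<^sup>+\<omega>. g \<omega> \<partial>return (X \<Otimes>\<^sub>M Z) (x, z) \<partial>Q x)"
    by (intro nn_integral_bind[OF assms] measurable_prob_algebraD)
  also have "\<dots> = (\<integral>\<^sup>+z. g (x, z) \<partial>Q x)"
    using x sets_eq_imp_space_eq[OF sets_Q[OF x]]
    by (intro nn_integral_cong nn_integral_return) (auto simp: space_pair_measure)
  finally show "(\<integral>\<^sup>+\<omega>. g \<omega> \<partial>(Q x \<bind> (\<lambda>z. return (X \<Otimes>\<^sub>M Z) (x, z)))) = (\<integral>\<^sup>+z. g (x, z) \<partial>Q x)" .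
qed

lemma distr_fst: "distr J X fst = M"
proof (rule measure_eqI)
  fix A assume "A \<in> sets (distr J X fst)"
  then have [measurable]: "A \<in> sets X" by simp
  have "emeasure (distr J X fst) A = (\<integral>\<^sup>+y. indicator A y \<partial>distr J X fst)" by simp
  also have "\<dots> = (\<integral>\<^sup>+\<omega>. indicator A (fst \<omega>) \<partial>J)" by (rule nn_integral_distr) auto
  also have "\<dots> = (\<integral>\<^sup>+x. indicator A x \<partial>M)"
  proof (subst nn_integral_J, measurable, rule nn_integral_cong)
    fix x assume "x \<in> space M"
    then show "(\<integral>\<^sup>+z. indicator A (fst (x, z)) \<partial>Q x) = indicator A x"
      using prob_space.emeasure_space_1[OF Q_prob_space] by (simp add: space_M)
  qed
  finally show "emeasure (distr J X fst) A = emeasure M A" by (simp add: sets_M)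
qed (simp add: sets_M)

lemma distr_snd: "distr J Z snd = N"
proof (rule measure_eqI)
  fix A assume "A \<in> sets (distr J Z snd)"
  then have A [measurable]: "A \<in> sets Z" by simp
  have "emeasure (distr J Z snd) A = (\<integral>\<^sup>+y. indicator A y \<partial>distr J Z snd)" by simp
  also have "\<dots> = (\<integral>\<^sup>+\<omega>. indicator A (snd \<omega>) \<partial>J)" by (rule nn_integral_distr) auto
  also have "\<dots> = (\<integral>\<^sup>+x. emeasure (Q x) A \<partial>M)"
    using sets_Q A by (subst nn_integral_J) (auto intro!: nn_integral_cong simp: space_M)
  also have "\<dots> = emeasure N A"
    by (rule emeasure_bind[OF M.not_empty Q_subprob A, symmetric])
  finally show "emeasure (distr J Z snd) A = emeasure N A" .
qed (simp add: sets_N)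

lemma integrable_fst_iff:
  fixes f :: "'x \<Rightarrow> real"
  assumes [measurable]: "f \<in> borel_measurable X"
  shows "integrable J (\<lambda>\<omega>. f (fst \<omega>)) \<longleftrightarrow> integrable M f"
  by (subst (2) distr_fst[symmetric]) (subst integrable_distr_eq, auto)

lemma integral_fst:
  fixes f :: "'x \<Rightarrow> real"
  assumes [measurable]: "f \<in> borel_measurable X"
  shows "(\<integral>\<omega>. f (fst \<omega>) \<partial>J) = (\<integral>x. f x \<partial>M)"
  by (subst (2) distr_fst[symmetric]) (subst integral_distr, auto)

lemma integrable_snd_iff:
  fixes f :: "'z \<Rightarrow> 'b :: {banach, second_countable_topology}"
  assumes [measurable]: "f \<in> borel_measurable Z"
  shows "integrable J (\<lambda>\<omega>. f (snd \<omega>)) \<longleftrightarrow> integrable N f"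
  by (subst distr_snd[symmetric]) (subst integrable_distr_eq, auto)

lemma integral_snd:
  fixes f :: "'z \<Rightarrow> 'b :: {banach, second_countable_topology}"
  assumes [measurable]: "f \<in> borel_measurable Z"
  shows "(\<integral>\<omega>. f (snd \<omega>) \<partial>J) = (\<integral>z. f z \<partial>N)"
  by (subst distr_snd[symmetric]) (subst integral_distr, auto)

lemma measurable_Q_measure:
  assumes A [measurable]: "A \<in> sets Z"
  shows "(\<lambda>x. measure (Q x) A) \<in> borel_measurable X"
  by (rule measurable_compose[OF Q_kernel measurable_measure_prob_algebra[OF A]])

lemma integrable_Q_measure_mult:
  fixes f :: "'x \<Rightarrow> real"
  assumes "A \<in> sets Z" and f: "integrable K f" and K: "sets K = sets X"
  shows "integrable K (\<lambda>x. measure (Q x) A * f x)"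
proof (rule Bochner_Integration.integrable_bound[OF f])
  have [measurable]: "(\<lambda>x. measure (Q x) A) \<in> borel_measurable K"
    using measurable_Q_measure[OF assms(1)] K by (simp cong: measurable_cong_sets)
  show "(\<lambda>x. measure (Q x) A * f x) \<in> borel_measurable K" using f by measurable
  show "AE x in K. norm (measure (Q x) A * f x) \<le> norm (f x)"
  proof (rule AE_I2)
    fix x assume "x \<in> space K"
    then have "x \<in> space X" using sets_eq_imp_space_eq[OF K] by simp
    then have "measure (Q x) A \<le> 1" using prob_space.prob_le_1[OF Q_prob_space] by simp
    then show "norm (measure (Q x) A * f x) \<le> norm (f x)"
      by (simp add: abs_mult mult_left_le_one_le)
  qed
qed

text \<open>This connects conditional expectations under \<open>J\<close> with the kernel: tested on \<open>Z \<in> A\<close>, the random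
  variable \<open>f(X)\<close> has the same integral as \<open>Q x A f(x)\<close>. The formula is Fubini for nonnegative \<open>f\<close>,
  and extends by splitting into positive and negative parts.\<close>

lemma integral_J_indicator_snd_mult_fst:
  fixes f :: "'x \<Rightarrow> real"
  assumes A [measurable]: "A \<in> sets Z" and f: "integrable M f"
  shows "(\<integral>\<omega>. indicator A (snd \<omega>) * f (fst \<omega>) \<partial>J) = (\<integral>x. measure (Q x) A * f x \<partial>M)"
proof -
  have [measurable]: "(\<lambda>x. measure (Q x) A) \<in> borel_measurable X" by (rule measurable_Q_measure[OF A])
  have nonneg: "(\<integral>\<omega>. indicator A (snd \<omega>) * g (fst \<omega>) \<partial>J) = (\<integral>x. measure (Q x) A * g x \<partial>M)"
    if [measurable]: "g \<in> borel_measurable X" and g: "\<And>x. 0 \<le> g x" for g :: "'x \<Rightarrow> real"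
  proof -
    have "(\<integral>\<^sup>+\<omega>. ennreal (indicator A (snd \<omega>) * g (fst \<omega>)) \<partial>J) =
        (\<integral>\<^sup>+x. \<integral>\<^sup>+z. ennreal (g x) * indicator A z \<partial>Q x \<partial>M)"
      by (subst nn_integral_J) (auto intro!: nn_integral_cong simp: indicator_def)
    also have "\<dots> = (\<integral>\<^sup>+x. ennreal (measure (Q x) A * g x) \<partial>M)"
    proof (rule nn_integral_cong)
      fix x assume "x \<in> space M"
      then have x: "x \<in> space X" by (simp add: space_M)
      interpret prob_space "Q x" by (rule Q_prob_space[OF x])
      show "(\<integral>\<^sup>+z. ennreal (g x) * indicator A z \<partial>Q x) = ennreal (measure (Q x) A * g x)"
        using g by (subst nn_integral_cmult_indicator)
          (auto simp: sets_Q[OF x] emeasure_eq_measure ennreal_mult mult.commute)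
    qed
    finally show ?thesis
      using g by (subst (1 2) integral_eq_nn_integral) auto
  qed
  have [measurable]: "f \<in> borel_measurable X"
    using borel_measurable_integrable[OF f] by (simp cong: measurable_cong_sets add: sets_M)
  have int_J: "integrable J (\<lambda>\<omega>. indicator A (snd \<omega>) * g (fst \<omega>))" if "integrable M g"
    and [measurable]: "g \<in> borel_measurable X" for g :: "'x \<Rightarrow> real"
  proof (rule Bochner_Integration.integrable_bound)
    show "integrable J (\<lambda>\<omega>. g (fst \<omega>))" using that by (simp add: integrable_fst_iff)
  qed (auto simp: indicator_def)
  define p n where "p x = max (f x) 0" and "n x = max (- f x) 0" for x
  have [measurable]: "p \<in> borel_measurable X" "n \<in> borel_measurable X"
    unfolding p_def[abs_def] n_def[abs_def] by measurable
  have "integrable M p" "integrable M n"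
    unfolding p_def[abs_def] n_def[abs_def] using f by auto
  note pn = this int_J[OF this(1)] int_J[OF this(2)]
    integrable_Q_measure_mult[OF A this(1) sets_M] integrable_Q_measure_mult[OF A this(2) sets_M]
  have f_eq: "f x = p x - n x" for x by (simp add: p_def n_def)
  have "0 \<le> p x" "0 \<le> n x" for x by (simp_all add: p_def n_def)
  with pn nonneg[of p] nonneg[of n] show ?thesis
    unfolding f_eq right_diff_distrib by simp
qed

lemma measure_N:
  assumes A: "A \<in> sets Z"
  shows "measure N A = (\<integral>x. measure (Q x) A \<partial>M)"
proof -
  have "measure N A = (\<integral>z. indicator A z \<partial>N)" using A by (simp add: sets_N)
  also have "\<dots> = (\<integral>\<omega>. indicator A (snd \<omega>) \<partial>J)" using A by (subst integral_snd[symmetric]) auto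
  finally show ?thesis using integral_J_indicator_snd_mult_fst[OF A, of "\<lambda>_. 1"] by simp
qed

sublocale J_F: finite_measure_subalgebra J F
proof
  have "snd \<in> J \<rightarrow>\<^sub>M Z" by measurable
  then have "sets F \<subseteq> sets J" by (rule sets_image_in_sets[OF refl])
  then show "subalgebra J F" by (simp add: subalgebra_def)
qed

lemma measurable_snd_F [measurable]: "snd \<in> F \<rightarrow>\<^sub>M Z"
  by (rule measurable_vimage_algebra1) (auto simp: space_J)

lemma sets_F_E:
  assumes "B \<in> sets F"
  obtains A where "A \<in> sets Z" "\<And>\<omega>. \<omega> \<in> space J \<Longrightarrow> indicator B \<omega> = (indicator A (snd \<omega>) :: real)"
proof -
  have "snd \<in> space J \<rightarrow> space Z" by (auto simp: space_J)
  with assms obtain A where "B = snd -` A \<inter> space J" "A \<in> sets Z"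
    by (auto simp: sets_vimage_algebra2)
  then show thesis by (intro that[of A]) (auto simp: indicator_def)
qed

definition cond_exp_component where
  "cond_exp_component f i = real_cond_exp J F (\<lambda>\<omega>. f (fst \<omega>) $ i)" for f :: "'x \<Rightarrow> real^'p"

lemma cond_exp_given_snd_nth: "cond_exp_given_snd J Z f \<omega> $ i = cond_exp_component f i \<omega>"
  by (simp add: cond_exp_given_snd_def cond_exp_component_def)

lemma cond_exp_component_measurable [measurable]:
  "cond_exp_component f i \<in> borel_measurable J"
  unfolding cond_exp_component_def by simp

lemma cond_exp_given_snd_measurable [measurable]:
  "cond_exp_given_snd J Z f \<in> borel_measurable J"
  by (simp add: borel_measurable_vec_iff cond_exp_given_snd_nth)

lemma cond_exp_version_component:
  assumes "cond_exp_version J Z f t"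
  shows "AE \<omega> in J. t (snd \<omega>) $ i = cond_exp_component f i \<omega>"
  using assms unfolding cond_exp_version_def
  by (auto elim!: eventually_mono simp: cond_exp_given_snd_nth)

lemma cond_exp_version_integrable:
  fixes f :: "'x \<Rightarrow> real^'p"
  assumes t: "cond_exp_version J Z f t" and f: "integrable M (\<lambda>x. f x $ i)"
    and [measurable]: "f \<in> borel_measurable X"
  shows "integrable N (\<lambda>z. t z $ i)"
proof -
  have [measurable]: "t \<in> borel_measurable Z" using t by (simp add: cond_exp_version_def)
  have "integrable J (cond_exp_component f i)"
    unfolding cond_exp_component_def using f by (intro J_F.real_cond_exp_int) (simp add: integrable_fst_iff[of "\<lambda>x. f x $ i"])
  then have "integrable J (\<lambda>\<omega>. t (snd \<omega>) $ i)"
    using cond_exp_version_component[OF t] by (subst integrable_cong_AE) auto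
  then show ?thesis by (simp add: integrable_snd_iff[of "\<lambda>z. t z $ i"])
qed

lemma cond_exp_version_integral:
  fixes f :: "'x \<Rightarrow> real^'p"
  assumes t: "cond_exp_version J Z f t" and f: "integrable M (\<lambda>x. f x $ i)"
    and f_meas [measurable]: "f \<in> borel_measurable X" and A [measurable]: "A \<in> sets Z"
  shows "(\<integral>z. indicator A z * t z $ i \<partial>N) = (\<integral>x. measure (Q x) A * f x $ i \<partial>M)"
proof -
  have [measurable]: "t \<in> borel_measurable Z" using t by (simp add: cond_exp_version_def)
  have int: "integrable J (\<lambda>\<omega>. indicator A (snd \<omega>) * f (fst \<omega>) $ i)"
  proof (rule Bochner_Integration.integrable_bound)
    show "integrable J (\<lambda>\<omega>. f (fst \<omega>) $ i)" using f by (simp add: integrable_fst_iff[of "\<lambda>x. f x $ i"])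
  qed (auto simp: indicator_def)
  have "(\<integral>z. indicator A z * t z $ i \<partial>N) = (\<integral>\<omega>. indicator A (snd \<omega>) * t (snd \<omega>) $ i \<partial>J)"
    by (subst integral_snd[symmetric]) auto
  also have "\<dots> = (\<integral>\<omega>. indicator A (snd \<omega>) * cond_exp_component f i \<omega> \<partial>J)"
    using cond_exp_version_component[OF t, of i] by (intro integral_cong_AE) auto
  also have "\<dots> = (\<integral>\<omega>. indicator A (snd \<omega>) * f (fst \<omega>) $ i \<partial>J)"
    unfolding cond_exp_component_def using int by (intro J_F.real_cond_exp_intg) auto
  also have "\<dots> = (\<integral>x. measure (Q x) A * f x $ i \<partial>M)"
    by (rule integral_J_indicator_snd_mult_fst[OF A f])
  finally show ?thesis .
qed

text \<open>A function of \<open>z\<close> with the integrals of \<open>f(X)\<close> on all events \<open>Z \<in> A\<close> is found as a Radon-Nikodym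
  density on \<open>Z\<close>: the image of \<open>f J\<close> under the second projection is a finite measure that
  vanishes on the null sets of \<open>N\<close>.\<close>

lemma factor_through_snd_nonneg:
  fixes f :: "'x \<Rightarrow> real"
  assumes f: "integrable M f" and [measurable]: "f \<in> borel_measurable X" and f0: "\<And>x. 0 \<le> f x"
  obtains g where "g \<in> borel_measurable Z" "integrable N g"
    "\<And>A. A \<in> sets Z \<Longrightarrow>
      (\<integral>\<omega>. indicator A (snd \<omega>) * g (snd \<omega>) \<partial>J) = (\<integral>\<omega>. indicator A (snd \<omega>) * f (fst \<omega>) \<partial>J)"
proof -
  define K where "K = distr (density J (\<lambda>\<omega>. ennreal (f (fst \<omega>)))) Z snd"
  have K: "emeasure K A = (\<integral>\<^sup>+\<omega>. ennreal (f (fst \<omega>)) * indicator A (snd \<omega>) \<partial>J)"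
    if [measurable]: "A \<in> sets Z" for A
    unfolding K_def
    by (subst emeasure_distr, simp, simp, subst emeasure_density)
      (auto intro!: nn_integral_cong simp: indicator_def)
  have fin: "(\<integral>\<^sup>+\<omega>. ennreal (f (fst \<omega>)) \<partial>J) < \<infinity>"
    using f f0 integrable_fst_iff[of f] by (simp add: integrable_iff_bounded)
  have "finite_measure K"
  proof
    have "emeasure K (space K) = emeasure K (space Z)" by (simp add: K_def)
    also have "\<dots> \<le> (\<integral>\<^sup>+\<omega>. ennreal (f (fst \<omega>)) \<partial>J)"
      by (subst K) (auto intro!: nn_integral_mono simp: indicator_def)
    finally show "emeasure K (space K) \<noteq> \<infinity>" using fin by auto
  qed
  moreover have ac: "absolutely_continuous N K"
  proof -
    have "A \<in> null_sets K" if A: "A \<in> null_sets N" for A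
    proof -
      have [measurable]: "A \<in> sets Z" using A sets_N by auto
      have "AE z in distr J Z snd. z \<notin> A" unfolding distr_snd by (rule AE_not_in[OF A])
      then have "AE \<omega> in J. snd \<omega> \<notin> A" by (rule AE_distrD[rotated]) measurable
      then have "emeasure K A = 0" by (subst K) (auto simp: nn_integral_0_iff_AE elim!: eventually_mono)
      then show ?thesis by (auto simp: K_def)
    qed
    then show ?thesis by (auto simp: absolutely_continuous_def)
  qed
  moreover have sets_K: "sets K = sets N" by (simp add: K_def sets_N)
  ultimately obtain g where g: "g \<in> borel_measurable N" "AE z in N. RN_deriv N K z = ennreal (g z)"
      "\<And>z. 0 \<le> g z"
    using N.real_RN_deriv[of K] by metis
  have g_meas [measurable]: "g \<in> borel_measurable Z" using g(1) by (simp add: sets_N cong: measurable_cong_sets)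
  have "K = density N (RN_deriv N K)" using N.density_RN_deriv[OF ac sets_K] by simp
  also have "\<dots> = density N (\<lambda>z. ennreal (g z))"
    using g(2) by (intro density_cong) (auto simp: sets_N)
  finally have K': "K = density N (\<lambda>z. ennreal (g z))" .
  have eq: "(\<integral>\<^sup>+\<omega>. ennreal (f (fst \<omega>)) * indicator A (snd \<omega>) \<partial>J) =
      (\<integral>\<^sup>+\<omega>. ennreal (g (snd \<omega>)) * indicator A (snd \<omega>) \<partial>J)" if [measurable]: "A \<in> sets Z" for A
  proof -
    have "emeasure K A = (\<integral>\<^sup>+z. ennreal (g z) * indicator A z \<partial>N)"
      by (subst K', subst emeasure_density) (auto simp: sets_N)
    also have "\<dots> = (\<integral>\<^sup>+\<omega>. ennreal (g (snd \<omega>)) * indicator A (snd \<omega>) \<partial>J)"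
      by (subst distr_snd[symmetric], subst nn_integral_distr) auto
    finally show ?thesis using K[OF that] by simp
  qed
  show thesis
  proof (rule that[OF g_meas])
    have "(\<integral>\<^sup>+\<omega>. ennreal (g (snd \<omega>)) \<partial>J) = (\<integral>\<^sup>+\<omega>. ennreal (g (snd \<omega>)) * indicator (space Z) (snd \<omega>) \<partial>J)"
      by (intro nn_integral_cong) (auto simp: space_J)
    also have "\<dots> = (\<integral>\<^sup>+\<omega>. ennreal (f (fst \<omega>)) * indicator (space Z) (snd \<omega>) \<partial>J)"
      by (simp add: eq)
    also have "\<dots> \<le> (\<integral>\<^sup>+\<omega>. ennreal (f (fst \<omega>)) \<partial>J)"
      by (intro nn_integral_mono) (auto simp: indicator_def)
    finally have "integrable J (\<lambda>\<omega>. g (snd \<omega>))"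
      using fin g(3) by (intro integrableI_nonneg) auto
    then show "integrable N g" by (simp add: integrable_snd_iff)
    show "(\<integral>\<omega>. indicator A (snd \<omega>) * g (snd \<omega>) \<partial>J) = (\<integral>\<omega>. indicator A (snd \<omega>) * f (fst \<omega>) \<partial>J)"
      if [measurable]: "A \<in> sets Z" for A
      using eq[OF that] f0 g(3)
      by (subst (1 2) integral_eq_nn_integral)
        (auto simp: ennreal_mult ennreal_indicator mult.commute)
  qed
qed

text \<open>A conditional expectation is only given as an \<open>F\<close>-measurable function on pairs. The densities of
  the positive and negative parts supply a function on \<open>Z\<close> representing it.\<close>

lemma real_cond_exp_factors_through_snd:
  fixes f :: "'x \<Rightarrow> real"
  assumes f: "integrable M f" and [measurable]: "f \<in> borel_measurable X"
  obtains g where "g \<in> borel_measurable Z"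
    "AE \<omega> in J. real_cond_exp J F (\<lambda>\<omega>. f (fst \<omega>)) \<omega> = g (snd \<omega>)"
proof -
  have max_int: "integrable M (\<lambda>x. max (f x) 0)" "integrable M (\<lambda>x. max (- f x) 0)"
    using f by simp_all
  obtain g1 where g1: "g1 \<in> borel_measurable Z" "integrable N g1" "\<And>A. A \<in> sets Z \<Longrightarrow>
      (\<integral>\<omega>. indicator A (snd \<omega>) * g1 (snd \<omega>) \<partial>J) = (\<integral>\<omega>. indicator A (snd \<omega>) * max (f (fst \<omega>)) 0 \<partial>J)"
    by (rule factor_through_snd_nonneg[OF max_int(1)]) auto
  obtain g2 where g2: "g2 \<in> borel_measurable Z" "integrable N g2" "\<And>A. A \<in> sets Z \<Longrightarrow>
      (\<integral>\<omega>. indicator A (snd \<omega>) * g2 (snd \<omega>) \<partial>J) = (\<integral>\<omega>. indicator A (snd \<omega>) * max (- f (fst \<omega>)) 0 \<partial>J)"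
    by (rule factor_through_snd_nonneg[OF max_int(2)]) auto
  note [measurable] = g1(1) g2(1)
  have intJ: "integrable J (\<lambda>\<omega>. g1 (snd \<omega>))" "integrable J (\<lambda>\<omega>. g2 (snd \<omega>))" "integrable J (\<lambda>\<omega>. f (fst \<omega>))"
    using g1 g2 f by (simp_all add: integrable_snd_iff integrable_fst_iff)
  have ind: "integrable J (\<lambda>\<omega>. indicator A (snd \<omega>) * h \<omega>)"
    if "integrable J h" "A \<in> sets Z" for A and h :: "'x \<times> 'z \<Rightarrow> real"
    by (rule Bochner_Integration.integrable_bound[OF that(1)])
      (use that in \<open>auto simp: indicator_def\<close>)
  show thesis
  proof (rule that)
    show "(\<lambda>z. g1 z - g2 z) \<in> borel_measurable Z" by measurable
    show "AE \<omega> in J. real_cond_exp J F (\<lambda>\<omega>. f (fst \<omega>)) \<omega> = g1 (snd \<omega>) - g2 (snd \<omega>)"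
    proof (rule J_F.real_cond_exp_charact)
      fix B assume "B \<in> sets F"
      then obtain A where A: "A \<in> sets Z"
        "\<And>\<omega>. \<omega> \<in> space J \<Longrightarrow> indicator B \<omega> = (indicator A (snd \<omega>) :: real)"
        by (rule sets_F_E) blast
      have "(\<integral>\<omega>\<in>B. f (fst \<omega>) \<partial>J) = (\<integral>\<omega>. indicator A (snd \<omega>) * f (fst \<omega>) \<partial>J)"
        unfolding set_lebesgue_integral_def using A by (intro Bochner_Integration.integral_cong) auto
      also have "\<dots> = (\<integral>\<omega>. indicator A (snd \<omega>) * max (f (fst \<omega>)) 0
          - indicator A (snd \<omega>) * max (- f (fst \<omega>)) 0 \<partial>J)"
        by (intro Bochner_Integration.integral_cong) (auto simp: indicator_def)
      also have "\<dots> = (\<integral>\<omega>. indicator A (snd \<omega>) * g1 (snd \<omega>) - indicator A (snd \<omega>) * g2 (snd \<omega>) \<partial>J)"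
        using ind[OF _ A(1)] intJ A(1) by (simp add: g1(3) g2(3))
      also have "\<dots> = (\<integral>\<omega>\<in>B. g1 (snd \<omega>) - g2 (snd \<omega>) \<partial>J)"
        unfolding set_lebesgue_integral_def using A
        by (intro Bochner_Integration.integral_cong) (simp_all add: right_diff_distrib)
      finally show "(\<integral>\<omega>\<in>B. f (fst \<omega>) \<partial>J) = (\<integral>\<omega>\<in>B. g1 (snd \<omega>) - g2 (snd \<omega>) \<partial>J)" .
    qed (use intJ in auto)
  qed
qed

lemma cond_exp_version_exists:
  fixes f :: "'x \<Rightarrow> real^'p"
  assumes f: "\<And>i. integrable M (\<lambda>x. f x $ i)" and [measurable]: "f \<in> borel_measurable X"
  obtains t where "cond_exp_version J Z f t"
proof -
  have "\<forall>i. \<exists>g. g \<in> borel_measurable Z \<and> (AE \<omega> in J. cond_exp_component f i \<omega> = g (snd \<omega>))"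
    unfolding cond_exp_component_def
    by (rule allI, rule real_cond_exp_factors_through_snd[OF f]) auto
  from choice[OF this] obtain g where g: "\<And>i. g i \<in> borel_measurable Z"
    "\<And>i. AE \<omega> in J. cond_exp_component f i \<omega> = g i (snd \<omega>)"
    by blast
  have "AE \<omega> in J. \<forall>i\<in>UNIV. cond_exp_component f i \<omega> = g i (snd \<omega>)"
    using g(2) by (intro AE_finite_allI) auto
  then have "AE \<omega> in J. (\<chi> i. g i (snd \<omega>)) = cond_exp_given_snd J Z f \<omega>"
    by eventually_elim (simp add: vec_eq_iff cond_exp_given_snd_nth)
  then show thesis
    using g(1) by (intro that[of "\<lambda>z. \<chi> i. g i z"]) (simp add: cond_exp_version_def borel_measurable_vec_iff)
qed

end

section \<open>Differentiability of the privatised model\<close>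

locale private_dqm_model = dqm_model X \<Theta> P \<mu> \<theta> s
  for X :: "'x measure" and \<Theta> :: "(real^'p) set" and P :: "real^'p \<Rightarrow> 'x measure"
    and \<mu> :: "'x measure" and \<theta> :: "real^'p" and s :: "'x \<Rightarrow> real^'p" +
  fixes \<alpha> :: real and Z :: "'z measure" and Q :: "'x \<Rightarrow> 'z measure"
  assumes Q_private: "Q \<in> private_kernels \<alpha> X Z"
begin

lemma Q_kernel': "Q \<in> X \<rightarrow>\<^sub>M prob_algebra Z"
  using Q_private by (simp add: private_kernels_def)

lemma channel_at: "\<tau> \<in> \<Theta> \<Longrightarrow> channel X Z (P \<tau>) Q"
  using laws Q_kernel' by unfold_locales auto

sublocale channel X Z "P \<theta>" Q
  by (rule channel_at) simp

abbreviation QP where "QP \<equiv> private_model Q P"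

lemma QP_\<theta>: "QP \<theta> = P \<theta> \<bind> Q"
  by (simp add: private_model_def)

lemma QP_laws:
  assumes "\<tau> \<in> \<Theta>"
  shows "QP \<tau> \<in> space (prob_algebra Z)"
proof -
  interpret \<tau>: channel X Z "P \<tau>" Q by (rule channel_at[OF assms])
  show ?thesis
    by (simp add: private_model_def space_prob_algebra \<tau>.sets_N \<tau>.N.prob_space_axioms)
qed

lemma privacy: "A \<in> sets Z \<Longrightarrow> x \<in> space X \<Longrightarrow> x' \<in> space X \<Longrightarrow>
    measure (Q x) A \<le> exp \<alpha> * measure (Q x') A"
  using Q_private by (auto simp: private_kernels_def)

text \<open>The privacy inequality averaged over its second point \<open>x'\<close> under \<open>P \<theta>\<close>.\<close>

lemma Q_measure_le_QP_measure:
  assumes A: "A \<in> sets Z" and x: "x \<in> space X"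
  shows "measure (Q x) A \<le> exp \<alpha> * measure (QP \<theta>) A"
proof -
  have int: "integrable (P \<theta>) (\<lambda>x'. measure (Q x') A)"
    using integrable_Q_measure_mult[OF A, of "P \<theta>" "\<lambda>_. 1"] sets_law_\<theta> by simp
  have "measure (Q x) A = (\<integral>x'. measure (Q x) A \<partial>P \<theta>)" by (simp add: law.prob_space)
  also have "\<dots> \<le> (\<integral>x'. exp \<alpha> * measure (Q x') A \<partial>P \<theta>)"
    using int privacy[OF A x] by (intro integral_mono) (auto simp: space_M)
  also have "\<dots> = exp \<alpha> * measure (QP \<theta>) A" by (simp add: QP_\<theta> measure_N[OF A])
  finally show ?thesis .
qed

text \<open>The contraction from \<open>L\<^sup>1\<close> to \<open>L\<^sup>\<infinity>\<close>: the signed measure on the left has a density with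
  respect to \<open>QP \<theta>\<close> that is bounded by \<open>e\<^sup>\<alpha>\<close> times the \<open>L\<^sup>1\<close> norm of \<open>f\<close>.\<close>

lemma abs_integral_Q_measure_le:
  fixes f :: "'x \<Rightarrow> real"
  assumes A: "A \<in> sets Z" and f: "integrable K f" and K: "sets K = sets X"
  shows "\<bar>\<integral>x. measure (Q x) A * f x \<partial>K\<bar> \<le> exp \<alpha> * (\<integral>x. \<bar>f x\<bar> \<partial>K) * measure (QP \<theta>) A"
proof -
  have "\<bar>\<integral>x. measure (Q x) A * f x \<partial>K\<bar> \<le> (\<integral>x. \<bar>measure (Q x) A * f x\<bar> \<partial>K)"
    by (rule integral_abs_bound)
  also have "\<dots> \<le> (\<integral>x. (exp \<alpha> * measure (QP \<theta>) A) * \<bar>f x\<bar> \<partial>K)"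
    using integrable_Q_measure_mult[OF A integrable_abs[OF f] K] f Q_measure_le_QP_measure[OF A] sets_eq_imp_space_eq[OF K]
    by (intro integral_mono) (auto simp: abs_mult intro!: mult_right_mono)
  finally show ?thesis by (simp add: mult_ac)
qed

lemma QP_absolutely_continuous:
  assumes \<tau>: "\<tau> \<in> \<Theta>"
  shows "absolutely_continuous (QP \<theta>) (QP \<tau>)"
  unfolding absolutely_continuous_def
proof
  interpret \<tau>: channel X Z "P \<tau>" Q by (rule channel_at[OF \<tau>])
  fix A assume "A \<in> null_sets (QP \<theta>)"
  then have A: "A \<in> sets Z" and "measure (QP \<theta>) A = 0"
    by (auto simp: QP_\<theta> sets_N measure_def)
  then have "measure (Q x) A = 0" if "x \<in> space X" for x
    using Q_measure_le_QP_measure[OF A that] by (simp add: measure_le_0_iff)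
  then have "measure (QP \<tau>) A = 0"
    unfolding private_model_def \<tau>.measure_N[OF A]
    by (intro integral_eq_zero_AE) (auto simp: \<tau>.space_M)
  then show "A \<in> null_sets (QP \<tau>)"
    using A by (auto simp: private_model_def \<tau>.sets_N \<tau>.N.emeasure_eq_measure)
qed

text \<open>Privacy makes all output laws mutually absolutely continuous, so the law at \<open>\<theta>\<close> dominates the
  privatised model.\<close>

lemma QP_dominated: "dominating_measure Z \<Theta> QP (QP \<theta>)"
  unfolding dominating_measure_def
  using QP_absolutely_continuous N.sigma_finite_measure_axioms by (auto simp: QP_\<theta> sets_N)

lemma AE_cond_exp_component_le:
  assumes t: "cond_exp_version J Z s t"
  shows "AE z in QP \<theta>. \<bar>t z $ i\<bar> \<le> exp \<alpha> * (\<integral>x. \<bar>s x $ i\<bar> \<partial>P \<theta>)"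
proof (rule AE_abs_le_if_abs_set_integral_le)
  show "integrable (QP \<theta>) (\<lambda>z. t z $ i)"
    unfolding QP_\<theta> by (rule cond_exp_version_integrable[OF t integrable_score_component]) measurable
  show "integrable (QP \<theta>) (\<lambda>z. exp \<alpha> * (\<integral>x. \<bar>s x $ i\<bar> \<partial>P \<theta>))"
    by (simp add: QP_\<theta>)
  fix A assume "A \<in> sets (QP \<theta>)"
  then have A: "A \<in> sets Z" by (simp add: QP_\<theta> sets_N)
  have "(\<integral>z. indicator A z * t z $ i \<partial>QP \<theta>) = (\<integral>x. measure (Q x) A * s x $ i \<partial>P \<theta>)"
    unfolding QP_\<theta> by (rule cond_exp_version_integral[OF t integrable_score_component _ A]) measurable
  moreover have "(\<integral>z. indicator A z * (exp \<alpha> * (\<integral>x. \<bar>s x $ i\<bar> \<partial>P \<theta>)) \<partial>QP \<theta>) =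
      exp \<alpha> * (\<integral>x. \<bar>s x $ i\<bar> \<partial>P \<theta>) * measure (QP \<theta>) A"
    using A sets.Int_space_eq2[of A "QP \<theta>"] by (simp add: QP_\<theta> sets_N mult_ac)
  ultimately show "\<bar>\<integral>z. indicator A z * t z $ i \<partial>QP \<theta>\<bar> \<le>
      (\<integral>z. indicator A z * (exp \<alpha> * (\<integral>x. \<bar>s x $ i\<bar> \<partial>P \<theta>)) \<partial>QP \<theta>)"
    using abs_integral_Q_measure_le[OF A integrable_score_component sets_law_\<theta>] by (simp only:)
qed

lemma abs_score_mean_le: "(\<integral>x. \<bar>s x $ i\<bar> \<partial>P \<theta>) \<le> sqrt (\<integral>x. (s x $ i)\<^sup>2 \<partial>P \<theta>)"
proof (rule real_le_rsqrt)
  have "0 \<le> law.variance (\<lambda>x. \<bar>s x $ i\<bar>)" by (rule law.variance_positive)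
  then show "(\<integral>x. \<bar>s x $ i\<bar> \<partial>P \<theta>)\<^sup>2 \<le> (\<integral>x. (s x $ i)\<^sup>2 \<partial>P \<theta>)"
    using integrable_score_component[of i] integrable_score_component_square[of i]
    by (subst (asm) law.variance_eq) auto
qed

lemma trace_fisher_information:
  "trace (fisher_information (P \<theta>) s) = (\<Sum>i\<in>UNIV. \<integral>x. (s x $ i)\<^sup>2 \<partial>P \<theta>)"
  by (simp add: trace_def fisher_information_def integral_outer_square_nth
      integrable_score_outer_square power2_eq_square)

text \<open>Averaging over the second point loses only one factor \<open>e\<^sup>\<alpha>\<close>, so this is smaller than the bound
  with \<open>e\<^bsup>2\<alpha>\<^esup>\<close>.\<close>

definition score_bound where
  "score_bound = exp \<alpha> * sqrt (trace (fisher_information (P \<theta>) s))"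

lemma score_bound_nonneg: "0 \<le> score_bound"
  unfolding score_bound_def trace_fisher_information by (intro mult_nonneg_nonneg) (auto intro: sum_nonneg)

lemma AE_norm_cond_exp_le:
  assumes t: "cond_exp_version J Z s t"
  shows "AE z in QP \<theta>. norm (t z) \<le> score_bound"
proof -
  have "AE z in QP \<theta>. \<forall>i\<in>UNIV. \<bar>t z $ i\<bar> \<le> exp \<alpha> * (\<integral>x. \<bar>s x $ i\<bar> \<partial>P \<theta>)"
    using AE_cond_exp_component_le[OF t] by (intro AE_finite_allI) auto
  then show ?thesis
  proof eventually_elim
    case (elim z)
    have "norm (t z) = sqrt (\<Sum>i\<in>UNIV. (t z $ i)\<^sup>2)"
      by (simp add: norm_vec_def L2_set_def)
    also have "\<dots> \<le> sqrt (\<Sum>i\<in>UNIV. (exp \<alpha>)\<^sup>2 * (\<integral>x. (s x $ i)\<^sup>2 \<partial>P \<theta>))"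
    proof (intro real_sqrt_le_mono sum_mono)
      fix i :: 'p
      let ?m = "\<integral>x. (s x $ i)\<^sup>2 \<partial>P \<theta>"
      have "\<bar>t z $ i\<bar> \<le> exp \<alpha> * sqrt ?m"
        using elim abs_score_mean_le[of i] by (meson UNIV_I exp_ge_zero mult_left_mono order_trans)
      then have "\<bar>t z $ i\<bar>\<^sup>2 \<le> (exp \<alpha> * sqrt ?m)\<^sup>2" by (intro power_mono) auto
      then show "(t z $ i)\<^sup>2 \<le> (exp \<alpha>)\<^sup>2 * ?m" by (simp add: power_mult_distrib)
    qed
    also have "\<dots> = score_bound"
      by (simp add: score_bound_def trace_fisher_information real_sqrt_mult sum_distrib_left[symmetric])
    finally show ?case .
  qed
qed

text \<open>Densities are taken with respect to the given \<open>\<nu>\<close>, with \<open>?m\<close> that of \<open>QP \<theta>\<close>. Testing on sets \<open>A\<close>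
  and pulling back through \<open>Q\<close> shows that the linearisation error of the output density has
  absolute value at most \<open>e\<^sup>\<alpha> \<parallel>linearisation_error h\<parallel>\<^sub>1 ?m\<close>. Together with the bound on \<open>t\<close>, the
  pointwise expansion of the square root applies at almost every \<open>z\<close>, and \<open>?m\<close> integrates to one.\<close>

lemma QP_dqm:
  assumes t: "cond_exp_version J Z s t" and \<nu>: "dominating_measure Z \<Theta> QP \<nu>"
  shows "dqm_with_score \<nu> \<Theta> QP \<theta> t"
proof -
  interpret Q: dominated_model Z \<Theta> QP \<nu>
    using QP_laws \<nu> by unfold_locales auto
  note [measurable_cong] = Q.sets_\<mu>
  have t_meas [measurable]: "t \<in> borel_measurable Z" using t by (simp add: cond_exp_version_def)
  have N_density: "P \<theta> \<bind> Q = density \<nu> (\<lambda>z. ennreal ((Q.rt \<theta> z)\<^sup>2))"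
    using Q.law_eq_density[OF \<theta>_in] by (simp add: QP_\<theta>)
  let ?m = "\<lambda>z. (Q.rt \<theta> z)\<^sup>2"
  have m: "integrable \<nu> ?m" "(\<integral>z. ?m z \<partial>\<nu>) = 1"
    by (simp_all add: Q.integrable_root_density_square Q.integral_root_density_square)
  have int_indicator: "(\<integral>z. indicator A z * (Q.rt \<tau> z)\<^sup>2 \<partial>\<nu>) = (\<integral>x. measure (Q x) A * (rt \<tau> x)\<^sup>2 \<partial>\<mu>)"
    if A: "A \<in> sets Z" and \<tau>: "\<tau> \<in> \<Theta>" for A \<tau>
  proof -
    interpret \<tau>: channel X Z "P \<tau>" Q by (rule channel_at[OF \<tau>])
    have "(\<integral>z. indicator A z * (Q.rt \<tau> z)\<^sup>2 \<partial>\<nu>) = (\<integral>z. indicator A z \<partial>QP \<tau>)"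
      using A by (subst Q.integral_law[OF \<tau>]) auto
    also have "\<dots> = measure (QP \<tau>) A"
      using A by (simp add: private_model_def \<tau>.sets_N)
    also have "\<dots> = (\<integral>x. measure (Q x) A \<partial>P \<tau>)"
      by (simp add: private_model_def \<tau>.measure_N[OF A])
    also have "\<dots> = (\<integral>x. measure (Q x) A * (rt \<tau> x)\<^sup>2 \<partial>\<mu>)"
      by (rule integral_law[OF \<tau> measurable_Q_measure[OF A]])
    finally show ?thesis .
  qed
  have t_int: "integrable \<nu> (\<lambda>z. (h \<bullet> t z) * ?m z)" for h
  proof -
    have "integrable (QP \<theta>) (\<lambda>z. h \<bullet> t z)"
      unfolding QP_\<theta> inner_vec_def
      by (auto intro!: Bochner_Integration.integrable_sum integrable_mult_right
          cond_exp_version_integrable[OF t integrable_score_component])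
    then show ?thesis by (subst (asm) Q.integrable_law_iff) auto
  qed
  have t_indicator: "(\<integral>z. indicator A z * ((h \<bullet> t z) * ?m z) \<partial>\<nu>) =
      (\<integral>x. measure (Q x) A * ((h \<bullet> s x) * (rt \<theta> x)\<^sup>2) \<partial>\<mu>)" if A: "A \<in> sets Z" for A h
  proof -
    have [measurable]: "(\<lambda>x. measure (Q x) A) \<in> borel_measurable X" by (rule measurable_Q_measure[OF A])
    have ti: "integrable (QP \<theta>) (\<lambda>z. indicator A z * t z $ i)" for i
      unfolding QP_\<theta>
      using A by (intro Bochner_Integration.integrable_bound[OF
            cond_exp_version_integrable[OF t integrable_score_component[of i]]])
        (auto simp: indicator_def)
    have "(\<integral>z. indicator A z * ((h \<bullet> t z) * ?m z) \<partial>\<nu>) = (\<integral>z. indicator A z * (h \<bullet> t z) \<partial>QP \<theta>)"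
      using A by (subst Q.integral_law) (auto simp: mult.assoc)
    also have "\<dots> = (\<integral>z. (\<Sum>i\<in>UNIV. h $ i * (indicator A z * t z $ i)) \<partial>QP \<theta>)"
      by (simp add: inner_vec_def sum_distrib_left mult_ac)
    also have "\<dots> = (\<Sum>i\<in>UNIV. h $ i * (\<integral>z. indicator A z * t z $ i \<partial>QP \<theta>))"
      using ti by simp
    also have "\<dots> = (\<Sum>i\<in>UNIV. h $ i * (\<integral>x. measure (Q x) A * s x $ i \<partial>P \<theta>))"
      unfolding QP_\<theta> using cond_exp_version_integral[OF t integrable_score_component score_measurable A]
      by simp
    also have "\<dots> = (\<integral>x. (\<Sum>i\<in>UNIV. h $ i * (measure (Q x) A * s x $ i)) \<partial>P \<theta>)"
      using integrable_Q_measure_mult[OF A integrable_score_component sets_law_\<theta>] by simp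
    also have "\<dots> = (\<integral>x. measure (Q x) A * (h \<bullet> s x) \<partial>P \<theta>)"
      by (simp add: inner_vec_def sum_distrib_left mult_ac)
    also have "\<dots> = (\<integral>x. measure (Q x) A * ((h \<bullet> s x) * (rt \<theta> x)\<^sup>2) \<partial>\<mu>)"
      by (subst integral_law) (auto simp: mult.assoc)
    finally show ?thesis .
  qed
  \<comment> \<open>The bound on \<open>t\<close> holds almost everywhere for \<open>QP \<theta>\<close> only. Where \<open>?m\<close> vanishes, \<open>t\<close> is not
    controlled, but there the linearisation bound makes the density at \<open>\<theta> + h\<close> vanish as well.\<close>
  have AE_t: "AE z in \<nu>. 0 < ?m z \<longrightarrow> norm (t z) \<le> score_bound"
    using AE_norm_cond_exp_le[OF t] unfolding QP_\<theta> N_density by (subst (asm) AE_density) auto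
  have AE_lin: "AE z in \<nu>. \<bar>(Q.rt (\<theta> + h) z)\<^sup>2 - ?m z - (h \<bullet> t z) * ?m z\<bar> \<le>
      exp \<alpha> * (\<integral>x. \<bar>linearisation_error h x\<bar> \<partial>\<mu>) * ?m z" if \<tau>: "\<theta> + h \<in> \<Theta>" for h
  proof (rule AE_abs_le_if_abs_set_integral_le)
    note n = Q.integrable_root_density_square[OF \<tau>]
    show "integrable \<nu> (\<lambda>z. (Q.rt (\<theta> + h) z)\<^sup>2 - ?m z - (h \<bullet> t z) * ?m z)"
      using n m t_int by simp
    show "integrable \<nu> (\<lambda>z. exp \<alpha> * (\<integral>x. \<bar>linearisation_error h x\<bar> \<partial>\<mu>) * ?m z)"
      using m by simp
    fix A assume "A \<in> sets \<nu>"
    then have A [measurable]: "A \<in> sets Z" by (simp add: Q.sets_\<mu>)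
    have ind: "integrable \<nu> (\<lambda>z. indicator A z * f z)" if "integrable \<nu> f" for f :: "'z \<Rightarrow> real"
      by (rule Bochner_Integration.integrable_bound[OF that]) (use that in \<open>auto simp: indicator_def\<close>)
    note qm = integrable_Q_measure_mult[OF A _ sets_\<mu>]
    have "(\<integral>z. indicator A z * ((Q.rt (\<theta> + h) z)\<^sup>2 - ?m z - (h \<bullet> t z) * ?m z) \<partial>\<nu>) =
        (\<integral>z. indicator A z * (Q.rt (\<theta> + h) z)\<^sup>2 \<partial>\<nu>) - (\<integral>z. indicator A z * ?m z \<partial>\<nu>)
          - (\<integral>z. indicator A z * ((h \<bullet> t z) * ?m z) \<partial>\<nu>)"
      unfolding right_diff_distrib using ind[OF n] ind[OF m(1)] ind[OF t_int] by simp
    also have "\<dots> = (\<integral>x. measure (Q x) A * linearisation_error h x \<partial>\<mu>)"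
      using qm[OF integrable_root_density_square[OF \<tau>]] qm[OF integrable_root_density_square[OF \<theta>_in]]
        qm[of "\<lambda>x. (h \<bullet> s x) * (rt \<theta> x)\<^sup>2"] integrable_inner_score[of h]
      unfolding linearisation_error_def right_diff_distrib
      by (simp add: int_indicator[OF A \<tau>] int_indicator[OF A \<theta>_in] t_indicator[OF A] integrable_law_iff)
    finally have "\<bar>\<integral>z. indicator A z * ((Q.rt (\<theta> + h) z)\<^sup>2 - ?m z - (h \<bullet> t z) * ?m z) \<partial>\<nu>\<bar> \<le>
        exp \<alpha> * (\<integral>x. \<bar>linearisation_error h x\<bar> \<partial>\<mu>) * measure (QP \<theta>) A"
      using abs_integral_Q_measure_le[OF A integrable_linearisation_error[OF \<tau>] sets_\<mu>] by simp
    also have "measure (QP \<theta>) A = (\<integral>z. indicator A z * ?m z \<partial>\<nu>)"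
      using A by (subst Q.integral_law[OF \<theta>_in, symmetric]) (auto simp: QP_\<theta> sets_N)
    also have "exp \<alpha> * (\<integral>x. \<bar>linearisation_error h x\<bar> \<partial>\<mu>) * (\<integral>z. indicator A z * ?m z \<partial>\<nu>) =
        (\<integral>z. indicator A z * (exp \<alpha> * (\<integral>x. \<bar>linearisation_error h x\<bar> \<partial>\<mu>) * ?m z) \<partial>\<nu>)"
      by (simp add: mult.left_commute flip: integral_mult_right_zero)
    finally show "\<bar>\<integral>z. indicator A z * ((Q.rt (\<theta> + h) z)\<^sup>2 - ?m z - (h \<bullet> t z) * ?m z) \<partial>\<nu>\<bar> \<le>
        (\<integral>z. indicator A z * (exp \<alpha> * (\<integral>x. \<bar>linearisation_error h x\<bar> \<partial>\<mu>) * ?m z) \<partial>\<nu>)" .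
  qed
  show ?thesis
  proof (rule Q.dqm_with_scoreI[OF \<theta>_interior])
    show "t \<in> borel_measurable \<nu>" by measurable
    fix e :: real assume e: "0 < e"
    \<comment> \<open>The root remainder is at most \<open>L + (L + \<parallel>h\<parallel> score_bound)\<^sup>2\<close> times the root of \<open>?m\<close>, with
      \<open>L\<close> the uniform error of the density. Each of the two terms gets half of \<open>sqrt e \<parallel>h\<parallel>\<close>.\<close>
    define q where "q = sqrt e / 2"
    have q: "0 < q" using e by (simp add: q_def)
    define C where "C = (q + score_bound)\<^sup>2"
    have "((\<lambda>h::real^'p. C * norm h) \<longlongrightarrow> C * norm (0 :: real^'p)) (at 0)"
      by (intro tendsto_intros)
    then have small: "\<forall>\<^sub>F h in at (0 :: real^'p). C * norm h < q"
      using q by (intro order_tendstoD(2)) auto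
    have "0 < q / exp \<alpha>" using q by simp
    from L1_linearisation[OF this] small
    show "\<forall>\<^sub>F h in at 0. (\<integral>\<^sup>+z. ennreal ((Q.remainder \<theta> t h z)\<^sup>2) \<partial>\<nu>) \<le> ennreal (e * (norm h)\<^sup>2)"
    proof eventually_elim
      case (elim h)
      then have \<tau>: "\<theta> + h \<in> \<Theta>" by simp
      define n where "n = norm h"
      have n: "0 \<le> n" "C * n \<le> q" using elim by (simp_all add: n_def)
      define L where "L = exp \<alpha> * (\<integral>x. \<bar>linearisation_error h x\<bar> \<partial>\<mu>)"
      have L: "0 \<le> L" "L \<le> q * n"
        using elim unfolding L_def n_def by (auto simp: pos_le_divide_eq mult_ac intro!: mult_nonneg_nonneg)
      have "AE z in \<nu>. (Q.remainder \<theta> t h z)\<^sup>2 \<le> e * n\<^sup>2 * ?m z"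
        using AE_t AE_lin[OF \<tau>]
      proof eventually_elim
        case (elim z)
        define a b u where "a = Q.rt (\<theta> + h) z" and "b = Q.rt \<theta> z" and "u = h \<bullet> t z"
        have lin: "\<bar>a\<^sup>2 - b\<^sup>2 - u * b\<^sup>2\<bar> \<le> L * b\<^sup>2"
          using elim(2) by (simp add: a_def b_def u_def L_def)
        have "\<bar>u\<bar> * b\<^sup>2 \<le> (n * score_bound) * b\<^sup>2"
        proof (cases "b = 0")
          case False
          then have "norm (t z) \<le> score_bound" using elim(1) by (simp add: b_def)
          then have "\<bar>u\<bar> \<le> n * score_bound"
            unfolding u_def n_def by (meson Cauchy_Schwarz_ineq2 mult_left_mono norm_ge_zero order_trans)
          then show ?thesis by (intro mult_right_mono) auto
        qed simp
        then have "\<bar>a\<^sup>2 - b\<^sup>2\<bar> \<le> (L + n * score_bound) * b\<^sup>2"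
          using lin abs_triangle_ineq[of "a\<^sup>2 - b\<^sup>2 - u * b\<^sup>2" "u * b\<^sup>2"]
          by (simp add: abs_mult distrib_right)
        from root_remainder_le[OF _ _ _ L(1) this lin]
        have "(a - b - 1/2 * u * b)\<^sup>2 \<le> (L + (L + n * score_bound)\<^sup>2)\<^sup>2 * b\<^sup>2"
          using L n score_bound_nonneg by (auto simp: a_def b_def Q.root_density_nonneg)
        also have "\<dots> \<le> (sqrt e * n)\<^sup>2 * b\<^sup>2"
        proof (intro mult_right_mono power_mono)
          have "(L + n * score_bound)\<^sup>2 \<le> (q * n + n * score_bound)\<^sup>2"
            using L n score_bound_nonneg by (intro power_mono) auto
          also have "\<dots> = (C * n) * n"
            by (simp add: C_def power2_eq_square algebra_simps)
          also have "\<dots> \<le> q * n" using n by (intro mult_right_mono) auto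
          finally show "L + (L + n * score_bound)\<^sup>2 \<le> sqrt e * n"
            using L by (simp add: q_def)
        qed (use L in auto)
        also have "\<dots> = e * n\<^sup>2 * b\<^sup>2" using e by (simp add: power_mult_distrib)
        finally show ?case by (simp add: Q.remainder_def a_def b_def u_def)
      qed
      then have "(\<integral>\<^sup>+z. ennreal ((Q.remainder \<theta> t h z)\<^sup>2) \<partial>\<nu>) \<le> (\<integral>\<^sup>+z. ennreal (e * n\<^sup>2 * ?m z) \<partial>\<nu>)"
        by (intro nn_integral_mono_AE) (auto intro: ennreal_leI elim!: eventually_mono)
      also have "\<dots> = ennreal (e * n\<^sup>2)"
        using m e by (subst nn_integral_eq_integral) auto
      finally show ?case by (simp add: n_def)
    qed
  qed
qed

section \<open>Fisher information of the privatised model\<close>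

lemma integrable_QP_t_product:
  assumes t: "cond_exp_version J Z s t"
  shows "integrable (QP \<theta>) (\<lambda>z. t z $ i * t z $ j)"
proof (rule Bochner_Integration.integrable_bound)
  have [measurable]: "t \<in> borel_measurable Z" using t by (simp add: cond_exp_version_def)
  show "integrable (QP \<theta>) (\<lambda>z. score_bound * score_bound)" by (simp add: QP_\<theta>)
  show "AE z in QP \<theta>. norm (t z $ i * t z $ j) \<le> norm (score_bound * score_bound)"
    using AE_norm_cond_exp_le[OF t]
  proof eventually_elim
    case (elim z)
    then have "\<bar>t z $ i\<bar> \<le> score_bound" "\<bar>t z $ j\<bar> \<le> score_bound"
      by (meson component_le_norm_cart order_trans)+
    then show ?case using score_bound_nonneg by (auto simp: abs_mult intro!: mult_mono)
  qed
  show "(\<lambda>z. t z $ i * t z $ j) \<in> borel_measurable (QP \<theta>)" unfolding QP_\<theta> by measurable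
qed

lemma integrable_J_score_t_product:
  assumes t: "cond_exp_version J Z s t"
  shows "integrable J (\<lambda>\<omega>. t (snd \<omega>) $ j * s (fst \<omega>) $ i)"
proof (rule Bochner_Integration.integrable_bound)
  have [measurable]: "t \<in> borel_measurable Z" using t by (simp add: cond_exp_version_def)
  show "integrable J (\<lambda>\<omega>. score_bound * s (fst \<omega>) $ i)"
    using integrable_score_component[of i] integrable_fst_iff[of "\<lambda>x. s x $ i"] by simp
  have "AE z in distr J Z snd. norm (t z) \<le> score_bound"
    using AE_norm_cond_exp_le[OF t] unfolding distr_snd QP_\<theta> .
  then have "AE \<omega> in J. norm (t (snd \<omega>)) \<le> score_bound" by (rule AE_distrD[rotated]) measurable
  then show "AE \<omega> in J. norm (t (snd \<omega>) $ j * s (fst \<omega>) $ i) \<le> norm (score_bound * s (fst \<omega>) $ i)"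
  proof eventually_elim
    case (elim \<omega>)
    then have "\<bar>t (snd \<omega>) $ j\<bar> \<le> score_bound"
      by (meson component_le_norm_cart order_trans)
    then show ?case using score_bound_nonneg by (auto simp: abs_mult intro!: mult_right_mono)
  qed
  show "(\<lambda>\<omega>. t (snd \<omega>) $ j * s (fst \<omega>) $ i) \<in> borel_measurable J" by measurable
qed

text \<open>The projection property \<open>\<bbbE>[t\<^sub>j(Z) s\<^sub>i(X)] = \<bbbE>[t\<^sub>j(Z) \<bbbE>[s\<^sub>i(X) | Z]]\<close>.\<close>

lemma integral_J_score_t_product:
  assumes t: "cond_exp_version J Z s t"
  shows "(\<integral>\<omega>. t (snd \<omega>) $ j * s (fst \<omega>) $ i \<partial>J) = (\<integral>z. t z $ j * t z $ i \<partial>QP \<theta>)"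
proof -
  have [measurable]: "t \<in> borel_measurable Z" using t by (simp add: cond_exp_version_def)
  have "(\<integral>\<omega>. t (snd \<omega>) $ j * s (fst \<omega>) $ i \<partial>J) = (\<integral>\<omega>. t (snd \<omega>) $ j * cond_exp_component s i \<omega> \<partial>J)"
    unfolding cond_exp_component_def
    by (rule J_F.real_cond_exp_intg(2)[symmetric, OF integrable_J_score_t_product[OF t]]) measurable
  also have "\<dots> = (\<integral>\<omega>. t (snd \<omega>) $ j * t (snd \<omega>) $ i \<partial>J)"
    using cond_exp_version_component[OF t, of i] by (intro integral_cong_AE) auto
  also have "\<dots> = (\<integral>z. t z $ j * t z $ i \<partial>QP \<theta>)"
    unfolding QP_\<theta> by (subst integral_snd[symmetric]) auto
  finally show ?thesis .
qed

text \<open>In the expansion of \<open>\<bbbE>[(s - t)\<^sub>i (s - t)\<^sub>j]\<close> both mixed terms equal \<open>\<bbbE>[t\<^sub>i t\<^sub>j]\<close>, and one of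
  them cancels the last term.\<close>

lemma fisher_information_QP:
  assumes t: "cond_exp_version J Z s t"
  shows "integrable (QP \<theta>) (\<lambda>z. outer_square (t z))"
    and "integrable J (\<lambda>(x, z). outer_square (s x - t z))"
    and "fisher_information (QP \<theta>) t =
      fisher_information (P \<theta>) s - (\<integral>(x, z). outer_square (s x - t z) \<partial>J)"
proof -
  have [measurable]: "t \<in> borel_measurable Z" using t by (simp add: cond_exp_version_def)
  show int_t: "integrable (QP \<theta>) (\<lambda>z. outer_square (t z))"
    by (simp add: integrable_outer_square_iff integrable_QP_t_product[OF t])
  have expand: "(s (fst \<omega>) - t (snd \<omega>)) $ i * (s (fst \<omega>) - t (snd \<omega>)) $ j =
      s (fst \<omega>) $ i * s (fst \<omega>) $ j - t (snd \<omega>) $ j * s (fst \<omega>) $ i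
        - t (snd \<omega>) $ i * s (fst \<omega>) $ j + t (snd \<omega>) $ i * t (snd \<omega>) $ j" for \<omega> i j
    by (simp add: algebra_simps)
  have ss: "integrable J (\<lambda>\<omega>. s (fst \<omega>) $ i * s (fst \<omega>) $ j)"
      "(\<integral>\<omega>. s (fst \<omega>) $ i * s (fst \<omega>) $ j \<partial>J) = (\<integral>x. s x $ i * s x $ j \<partial>P \<theta>)" for i j
    using integrable_fst_iff[of "\<lambda>x. s x $ i * s x $ j"] integral_fst[of "\<lambda>x. s x $ i * s x $ j"]
      integrable_score_product by simp_all
  have tt: "integrable J (\<lambda>\<omega>. t (snd \<omega>) $ i * t (snd \<omega>) $ j)"
      "(\<integral>\<omega>. t (snd \<omega>) $ i * t (snd \<omega>) $ j \<partial>J) = (\<integral>z. t z $ i * t z $ j \<partial>QP \<theta>)" for i j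
    using integrable_snd_iff[of "\<lambda>z. t z $ i * t z $ j"] integral_snd[of "\<lambda>z. t z $ i * t z $ j"]
      integrable_QP_t_product[OF t] by (simp_all add: QP_\<theta>)
  note st = integrable_J_score_t_product[OF t] integral_J_score_t_product[OF t]
  have int_J: "integrable J (\<lambda>\<omega>. outer_square (s (fst \<omega>) - t (snd \<omega>)))"
    unfolding integrable_outer_square_iff expand using ss tt st by simp
  then show "integrable J (\<lambda>(x, z). outer_square (s x - t z))"
    by (simp add: split_beta')
  show "fisher_information (QP \<theta>) t =
      fisher_information (P \<theta>) s - (\<integral>(x, z). outer_square (s x - t z) \<partial>J)"
    unfolding vec_eq_iff
  proof (intro allI)
    fix i j
    have "(\<integral>(x, z). outer_square (s x - t z) \<partial>J) $ i $ j =
        (\<integral>x. s x $ i * s x $ j \<partial>P \<theta>) - (\<integral>z. t z $ i * t z $ j \<partial>QP \<theta>)"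
      unfolding split_beta' integral_outer_square_nth[OF int_J] expand
      using ss tt st by (simp add: mult.commute)
    then show "fisher_information (QP \<theta>) t $ i $ j =
        (fisher_information (P \<theta>) s - (\<integral>(x, z). outer_square (s x - t z) \<partial>J)) $ i $ j"
      by (simp add: fisher_information_def integral_outer_square_nth[OF int_t]
          integral_outer_square_nth[OF integrable_score_outer_square])
  qed
qed

lemma fisher_information_QP_eq_covariance:
  assumes t: "cond_exp_version J Z s t"
  shows "fisher_information (QP \<theta>) t = covariance_matrix J (cond_exp_given_snd J Z s)"
proof -
  have t_meas [measurable]: "t \<in> borel_measurable Z" using t by (simp add: cond_exp_version_def)
  have outer_meas [measurable]: "(\<lambda>x. outer_square (f x)) \<in> borel_measurable M"
    if [measurable]: "f \<in> borel_measurable M" for f :: "'a \<Rightarrow> real^'p" and M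
  proof -
    have "continuous_on UNIV (outer_square :: real^'p \<Rightarrow> real^'p^'p)"
      unfolding outer_square_def by (intro continuous_intros)
    then show ?thesis
      by (rule borel_measurable_continuous_on[OF _ that])
  qed
  have comp: "integrable J (cond_exp_component s i)" "(\<integral>\<omega>. cond_exp_component s i \<omega> \<partial>J) = 0" for i
  proof -
    have "integrable J (\<lambda>\<omega>. s (fst \<omega>) $ i)" "(\<integral>\<omega>. s (fst \<omega>) $ i \<partial>J) = 0"
      using integrable_fst_iff[of "\<lambda>x. s x $ i"] integral_fst[of "\<lambda>x. s x $ i"]
        integrable_score_component score_mean_zero by simp_all
    then show "integrable J (cond_exp_component s i)" "(\<integral>\<omega>. cond_exp_component s i \<omega> \<partial>J) = 0"
      unfolding cond_exp_component_def using J_F.real_cond_exp_int by auto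
  qed
  have "integrable J (cond_exp_given_snd J Z s)"
    by (simp add: integrable_vec_iff cond_exp_given_snd_nth comp)
  then have mean: "(\<integral>\<omega>. cond_exp_given_snd J Z s \<omega> \<partial>J) = 0"
    by (simp add: vec_eq_iff integral_vec_nth cond_exp_given_snd_nth comp)
  have AE_t: "AE \<omega> in J. t (snd \<omega>) = cond_exp_given_snd J Z s \<omega>"
    using t by (simp add: cond_exp_version_def)
  have "covariance_matrix J (cond_exp_given_snd J Z s) = (\<integral>\<omega>. outer_square (t (snd \<omega>)) \<partial>J)"
    unfolding covariance_matrix_def mean using AE_t by (intro integral_cong_AE) auto
  also have "\<dots> = fisher_information (QP \<theta>) t"
    unfolding fisher_information_def QP_\<theta> by (subst integral_snd[symmetric]) auto
  finally show ?thesis by simp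
qed

text \<open>Any version satisfies the bound almost everywhere, so resetting it to zero where the bound fails
  gives a version that satisfies it everywhere.\<close>

lemma bounded_version_exists:
  obtains t where "cond_exp_version J Z s t" "\<And>z. norm (t z) \<le> score_bound"
proof -
  obtain t where t: "cond_exp_version J Z s t"
    by (rule cond_exp_version_exists[OF integrable_score_component score_measurable])
  have [measurable]: "t \<in> borel_measurable Z" using t by (simp add: cond_exp_version_def)
  define t' where "t' z = (if norm (t z) \<le> score_bound then t z else 0)" for z
  have [measurable]: "t' \<in> borel_measurable Z" unfolding t'_def[abs_def] by measurable
  have "AE z in distr J Z snd. norm (t z) \<le> score_bound"
    using AE_norm_cond_exp_le[OF t] unfolding distr_snd QP_\<theta> .
  then have "AE \<omega> in J. norm (t (snd \<omega>)) \<le> score_bound" by (rule AE_distrD[rotated]) measurable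
  moreover have "AE \<omega> in J. t (snd \<omega>) = cond_exp_given_snd J Z s \<omega>"
    using t by (simp add: cond_exp_version_def)
  ultimately have "AE \<omega> in J. t' (snd \<omega>) = cond_exp_given_snd J Z s \<omega>"
    by eventually_elim (simp add: t'_def)
  then have "cond_exp_version J Z s t'" by (simp add: cond_exp_version_def)
  then show thesis by (rule that) (simp add: t'_def score_bound_nonneg)
qed

end

section \<open>Scores and information under local differential privacy\<close>

theorem lemma3p1:
  fixes \<alpha> :: real
    and X :: "'x measure" and Z :: "'z measure" and \<mu> :: "'x measure"
    and \<Theta> :: "(real^'p) set" and \<theta> :: "real^'p"
    and P :: "real^'p \<Rightarrow> 'x measure" and s :: "'x \<Rightarrow> real^'p"
    and Q :: "'x \<Rightarrow> 'z measure"
  assumes "0 < \<alpha>"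
    and "\<forall>\<tau>\<in>\<Theta>. P \<tau> \<in> space (prob_algebra X)"
    and "dominating_measure X \<Theta> P \<mu>"
    and "dqm_with_score \<mu> \<Theta> P \<theta> s"
    and "Q \<in> private_kernels \<alpha> X Z"
  shows
    "let QP = private_model Q P; J = joint_law X Z (P \<theta>) Q in
       (\<exists>\<nu>. dominating_measure Z \<Theta> QP \<nu>) \<and>
       (\<forall>t. cond_exp_version J Z s t \<longrightarrow>
          (\<forall>\<nu>. dominating_measure Z \<Theta> QP \<nu> \<longrightarrow> dqm_with_score \<nu> \<Theta> QP \<theta> t) \<and>
          integrable (P \<theta>) (\<lambda>x. outer_square (s x)) \<and>
          integrable (QP \<theta>) (\<lambda>z. outer_square (t z)) \<and>
          integrable J (\<lambda>(x, z). outer_square (s x - t z)) \<and>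
          fisher_information (QP \<theta>) t = covariance_matrix J (cond_exp_given_snd J Z s) \<and>
          fisher_information (QP \<theta>) t =
            fisher_information (P \<theta>) s - (\<integral>(x, z). outer_square (s x - t z) \<partial>J)) \<and>
       (\<exists>t. cond_exp_version J Z s t \<and>
          (\<forall>z\<in>space Z. norm (t z) \<le> exp (2 * \<alpha>) * sqrt (trace (fisher_information (P \<theta>) s))))"
proof -
  interpret private_dqm_model X \<Theta> P \<mu> \<theta> s \<alpha> Z Q
    using assms by unfold_locales
  have "0 \<le> sqrt (trace (fisher_information (P \<theta>) s))"
    unfolding trace_fisher_information by (simp add: sum_nonneg)
  then have bound: "score_bound \<le> exp (2 * \<alpha>) * sqrt (trace (fisher_information (P \<theta>) s))"
    unfolding score_bound_def using assms(1) by (intro mult_right_mono) auto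
  obtain t where "cond_exp_version J Z s t" "\<And>z. norm (t z) \<le> score_bound"
    by (rule bounded_version_exists) blast
  then have "\<exists>t. cond_exp_version J Z s t \<and>
      (\<forall>z\<in>space Z. norm (t z) \<le> exp (2 * \<alpha>) * sqrt (trace (fisher_information (P \<theta>) s)))"
    using bound by (meson order_trans)
  then show ?thesis
    unfolding Let_def
    using QP_dominated QP_dqm integrable_score_outer_square fisher_information_QP
      fisher_information_QP_eq_covariance
    by blast
qed

end
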